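(* Let $n\in\mathbb{N}$, let $\phi=(\phi_1,\dots,\phi_n):U^n\to U^n$ be holomorphic, and let $p,q>0$. Consider the condition $$(\ast)\qquad \lim_{\phi(z)\to\partial U^n}\ \sum_{k,l=1}^n\left|\frac{\partial \phi_l}{\partial z_k}(z)\right|\frac{(1-|z_k|^2)^q}{(1-|\phi_l(z)|^2)^p}=0 .$$ (a) If $C_\phi$ is a bounded operator from $\mathcal{B}^p_0(U^n)$ to $\mathcal{B}^q_0(U^n)$ and $(\ast)$ holds, then $C_\phi$ is a compact operator from $\mathcal{B}^p_0(U^n)$ to $\mathcal{B}^q_0(U^n)$. (b) Let $p\ge 1$ and $q>0$. If $C_\phi$ is a compact operator from $\mathcal{B}^p_0(U^n)$ to $\mathcal{B}^q_0(U^n)$, then $\phi^\gamma\in\mathcal{B}^q_0(U^n)$ for every $n$-multi-index $\gamma$, and $(\ast)$ holds.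
   Context: $U$ is the open unit disk in $\mathbb{C}$, $U^n\subset\mathbb{C}^n$ is the open unit polydisk, and $\partial U^n$ is its topological boundary. For a holomorphic self-map $\phi$ of $U^n$, the composition operator is $C_\phi f=f\circ\phi$ for $f$ holomorphic on $U^n$. An $n$-multi-index is an $n$-tuple $\gamma=(\gamma_1,\dots,\gamma_n)$ of nonnegative integers, and $\phi^\gamma=\phi_1^{\gamma_1}\cdots\phi_n^{\gamma_n}$. For $p>0$, the $p$-Bloch space $\mathcal{B}^p(U^n)$ is the Banach space of holomorphic $f:U^n\to\mathbb{C}$ with finite norm $$\|f\|_{\mathcal{B}^p}=|f(0)|+\sup_{z\in U^n}\sum_{k=1}^n\left|\frac{\partial f}{\partial z_k}(z)\right|(1-|z_k|^2)^p .$$ The little $p$-Bloch space $\mathcal{B}^p_0(U^n)$ is the closure of the polynomials in $\mathcal{B}^p(U^n)$, with the same norm. The limit condition $\lim_{\phi(z)\to\partial U^n}S(z)=0$ means: for every $\varepsilon>0$ there is $\delta>0$ such that $|S(z)|<\varepsilon$ for all $z\in U^n$ whose image $\phi(z)$ has Euclidean distance less than $\delta$ to $\partial U^n$ (vacuously true if $\phi(U^n)$ stays away from $\partial U^n$). Bounded or compact operators from $X$ to $Y$ are in particular required to map $X$ into $Y$. *)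

theory Defs
  imports "HOL-Analysis.Analysis"
begin

text \<open>The dimension \<open>n \<ge> 1\<close> is the cardinality of the finite index type \<open>'n\<close>; the norm of
  \<^typ>\<open>complex ^ 'n\<close> is the Euclidean one.\<close>

definition polydisk :: "(complex ^ 'n) set" where
  "polydisk = {z. \<forall>k. cmod (z $ k) < 1}"

text \<open>Complex Frechet differentiability at every point of an open set: the real derivative is
  required to be a complex-linear functional.\<close>

definition holomorphic_n :: "(complex ^ 'n) set \<Rightarrow> (complex ^ 'n \<Rightarrow> complex) \<Rightarrow> bool" where
  "holomorphic_n S f \<longleftrightarrow>
     (\<forall>z\<in>S. \<exists>c :: complex ^ 'n. (f has_derivative (\<lambda>h. \<Sum>k\<in>UNIV. c $ k * h $ k)) (at z))"

definition holomorphic_self_map :: "(complex ^ 'n \<Rightarrow> complex ^ 'n) \<Rightarrow> bool" where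
  "holomorphic_self_map \<phi> \<longleftrightarrow>
     \<phi> ` polydisk \<subseteq> polydisk \<and> (\<forall>l. holomorphic_n polydisk (\<lambda>z. \<phi> z $ l))"

definition cpartial :: "'n \<Rightarrow> (complex ^ 'n \<Rightarrow> complex) \<Rightarrow> complex ^ 'n \<Rightarrow> complex" where
  "cpartial k f z = deriv (\<lambda>w. f (\<chi> j. if j = k then w else z $ j)) (z $ k)"

text \<open>A function on the polydisk is represented by its extension by zero to the whole type, so
  that equality in the function spaces below is equality on the polydisk.\<close>

definition zero_ext :: "(complex ^ 'n \<Rightarrow> complex) \<Rightarrow> complex ^ 'n \<Rightarrow> complex" where
  "zero_ext f = (\<lambda>z. if z \<in> polydisk then f z else 0)"

definition bloch_weight :: "real \<Rightarrow> (complex ^ 'n \<Rightarrow> complex) \<Rightarrow> complex ^ 'n \<Rightarrow> real" where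
  "bloch_weight p f z = (\<Sum>k\<in>UNIV. cmod (cpartial k f z) * (1 - (cmod (z $ k))\<^sup>2) powr p)"

definition bloch_norm :: "real \<Rightarrow> (complex ^ 'n \<Rightarrow> complex) \<Rightarrow> real" where
  "bloch_norm p f = cmod (f 0) + (SUP z\<in>polydisk. bloch_weight p f z)"

definition bloch :: "real \<Rightarrow> (complex ^ 'n \<Rightarrow> complex) set" where
  "bloch p = {f. holomorphic_n polydisk f \<and> (\<forall>z. z \<notin> polydisk \<longrightarrow> f z = 0) \<and>
                 bdd_above (bloch_weight p f ` polydisk)}"

text \<open>\<^locale>\<open>Metric_space\<close> requires symmetry and nonnegativity also off the carrier, hence the
  default value \<open>0\<close> there.\<close>

definition norm_dist ::
    "('a \<Rightarrow> complex) set \<Rightarrow> (('a \<Rightarrow> complex) \<Rightarrow> real) \<Rightarrow>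
     ('a \<Rightarrow> complex) \<Rightarrow> ('a \<Rightarrow> complex) \<Rightarrow> real" where
  "norm_dist X N f g = (if f \<in> X \<and> g \<in> X then N (\<lambda>z. f z - g z) else 0)"

definition norm_topology ::
    "('a \<Rightarrow> complex) set \<Rightarrow> (('a \<Rightarrow> complex) \<Rightarrow> real) \<Rightarrow> ('a \<Rightarrow> complex) topology" where
  "norm_topology X N = Metric_space.mtopology X (norm_dist X N)"

definition poly_functions :: "(complex ^ 'n \<Rightarrow> complex) set" where
  "poly_functions = {P. \<exists>(A :: ('n \<Rightarrow> nat) set) a. finite A \<and>
     P = (\<lambda>z. \<Sum>\<gamma>\<in>A. a \<gamma> * (\<Prod>k\<in>UNIV. (z $ k) ^ \<gamma> k))}"

definition little_bloch :: "real \<Rightarrow> (complex ^ 'n \<Rightarrow> complex) set" where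
  "little_bloch p =
     norm_topology (bloch p) (bloch_norm p) closure_of (zero_ext ` poly_functions)"

definition comp_op ::
    "(complex ^ 'n \<Rightarrow> complex ^ 'n) \<Rightarrow> (complex ^ 'n \<Rightarrow> complex) \<Rightarrow> complex ^ 'n \<Rightarrow> complex" where
  "comp_op \<phi> f = zero_ext (f \<circ> \<phi>)"

definition linear_operator ::
    "('a \<Rightarrow> complex) set \<Rightarrow> ('b \<Rightarrow> complex) set \<Rightarrow> (('a \<Rightarrow> complex) \<Rightarrow> 'b \<Rightarrow> complex) \<Rightarrow> bool" where
  "linear_operator X Y T \<longleftrightarrow> T ` X \<subseteq> Y \<and>
     (\<forall>f\<in>X. \<forall>g\<in>X. T (\<lambda>z. f z + g z) = (\<lambda>z. T f z + T g z)) \<and>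
     (\<forall>c. \<forall>f\<in>X. T (\<lambda>z. c * f z) = (\<lambda>z. c * T f z))"

definition bounded_operator ::
    "('a \<Rightarrow> complex) set \<Rightarrow> (('a \<Rightarrow> complex) \<Rightarrow> real) \<Rightarrow>
     ('b \<Rightarrow> complex) set \<Rightarrow> (('b \<Rightarrow> complex) \<Rightarrow> real) \<Rightarrow>
     (('a \<Rightarrow> complex) \<Rightarrow> 'b \<Rightarrow> complex) \<Rightarrow> bool" where
  "bounded_operator X NX Y NY T \<longleftrightarrow>
     linear_operator X Y T \<and> (\<exists>M. \<forall>f\<in>X. NY (T f) \<le> M * NX f)"

text \<open>Bounded sets have relatively compact images.\<close>

definition compact_operator ::
    "('a \<Rightarrow> complex) set \<Rightarrow> (('a \<Rightarrow> complex) \<Rightarrow> real) \<Rightarrow>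
     ('b \<Rightarrow> complex) set \<Rightarrow> (('b \<Rightarrow> complex) \<Rightarrow> real) \<Rightarrow>
     (('a \<Rightarrow> complex) \<Rightarrow> 'b \<Rightarrow> complex) \<Rightarrow> bool" where
  "compact_operator X NX Y NY T \<longleftrightarrow>
     linear_operator X Y T \<and>
     (\<forall>B \<subseteq> X. (\<exists>M. \<forall>f\<in>B. NX f \<le> M) \<longrightarrow>
        compactin (norm_topology Y NY) (norm_topology Y NY closure_of (T ` B)))"

definition tends_to_zero_at_boundary ::
    "(complex ^ 'n \<Rightarrow> complex ^ 'n) \<Rightarrow> (complex ^ 'n \<Rightarrow> real) \<Rightarrow> bool" where
  "tends_to_zero_at_boundary \<phi> S \<longleftrightarrow>
     (\<forall>\<epsilon>>0. \<exists>\<delta>>0. \<forall>z\<in>polydisk.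
        infdist (\<phi> z) (frontier polydisk) < \<delta> \<longrightarrow> \<bar>S z\<bar> < \<epsilon>)"

definition boundary_condition ::
    "real \<Rightarrow> real \<Rightarrow> (complex ^ 'n \<Rightarrow> complex ^ 'n) \<Rightarrow> bool" where
  "boundary_condition p q \<phi> \<longleftrightarrow>
     tends_to_zero_at_boundary \<phi> (\<lambda>z. \<Sum>k\<in>UNIV. \<Sum>l\<in>UNIV.
       cmod (cpartial k (\<lambda>w. \<phi> w $ l) z) *
       ((1 - (cmod (z $ k))\<^sup>2) powr q / (1 - (cmod (\<phi> z $ l))\<^sup>2) powr p))"


subsection \<open>The Bloch norm induces a metric\<close>

lemma open_polydisk: "open (polydisk :: (complex ^ 'n) set)"
proof -
  have eq: "polydisk = (\<Inter>k. {z :: complex ^ 'n. cmod (z $ k) < 1})"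
    by (auto simp: polydisk_def)
  show ?thesis
    unfolding eq by (auto intro!: open_INT open_Collect_less continuous_intros)
qed

lemma convex_polydisk: "convex (polydisk :: (complex ^ 'n) set)"
proof -
  have eq: "polydisk = (\<Inter>k. (\<lambda>z :: complex ^ 'n. z $ k) -` ball 0 1)"
    by (auto simp: polydisk_def)
  have "convex ((\<lambda>z :: complex ^ 'n. z $ k) -` ball 0 1)" for k
    by (intro convex_linear_vimage convex_ball linear_componentwise bounded_linear.linear
        bounded_linear_vec_nth)
  then show ?thesis unfolding eq by (simp add: convex_INT)
qed

lemma zero_in_polydisk: "0 \<in> polydisk"
  by (simp add: polydisk_def)

lemma has_cpartial:
  fixes c :: "complex ^ 'n"
  assumes "(f has_derivative (\<lambda>h. \<Sum>k\<in>UNIV. c $ k * h $ k)) (at z)"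
  shows "cpartial k f z = c $ k"
proof -
  define g :: "complex \<Rightarrow> complex ^ 'n" where "g w = (\<chi> j. if j = k then w else z $ j)" for w
  have g_eq: "g w = z + (\<chi> j. if j = k then w - z $ k else 0)" for w
    by (simp add: g_def vec_eq_iff)
  have bl: "bounded_linear (\<lambda>h. (\<chi> j. if j = k then h else 0) :: complex ^ 'n)"
  proof (rule linear_conv_bounded_linear[THEN iffD1])
    show "linear (\<lambda>h. (\<chi> j. if j = k then h else 0) :: complex ^ 'n)"
      by (rule linearI) (auto simp: vec_eq_iff)
  qed
  have "((\<lambda>w. w - z $ k) has_derivative (\<lambda>h. h)) (at (z $ k))"
    by (auto intro!: derivative_eq_intros)
  from has_derivative_add[OF has_derivative_const[of z] bounded_linear.has_derivative[OF bl this]]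
  have gd: "(g has_derivative (\<lambda>h. \<chi> j. if j = k then h else 0)) (at (z $ k))"
    unfolding g_eq[abs_def] by simp
  have gz: "g (z $ k) = z" by (simp add: g_def vec_eq_iff)
  have "((\<lambda>w. f (g w)) has_derivative
      (\<lambda>h. \<Sum>i\<in>UNIV. c $ i * (\<chi> j. if j = k then h else 0) $ i)) (at (z $ k))"
    by (rule has_derivative_compose[OF gd]) (unfold gz, rule assms)
  moreover have "(\<lambda>h. \<Sum>i\<in>UNIV. c $ i * (\<chi> j. if j = k then h else 0) $ i) = (*) (c $ k)"
    by (auto simp: if_distrib sum.delta cong: if_cong)
  ultimately have "((\<lambda>w. f (g w)) has_field_derivative c $ k) (at (z $ k))"
    by (simp add: has_field_derivative_def)
  then show ?thesis
    unfolding cpartial_def g_def by (rule DERIV_imp_deriv)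
qed

lemma holomorphic_n_has_derivative:
  fixes z :: "complex ^ 'n"
  assumes "holomorphic_n S f" "z \<in> S"
  shows "(f has_derivative (\<lambda>h. \<Sum>k\<in>UNIV. cpartial k f z * h $ k)) (at z)"
proof -
  obtain c :: "complex ^ 'n"
    where c: "(f has_derivative (\<lambda>h. \<Sum>k\<in>UNIV. c $ k * h $ k)) (at z)"
    using assms by (auto simp: holomorphic_n_def)
  then show ?thesis by (simp add: has_cpartial[OF c])
qed

lemma diff_derivative:
  fixes z :: "complex ^ 'n"
  assumes "holomorphic_n S f" "holomorphic_n S g" "z \<in> S"
  shows "((\<lambda>z. f z - g z) has_derivative
    (\<lambda>h. \<Sum>k\<in>UNIV. (\<chi> k. cpartial k f z - cpartial k g z) $ k * h $ k)) (at z)"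
  using has_derivative_diff[OF holomorphic_n_has_derivative[OF assms(1,3)]
      holomorphic_n_has_derivative[OF assms(2,3)]]
  by (simp add: sum_subtractf left_diff_distrib)

lemma cpartial_diff:
  assumes "holomorphic_n S f" "holomorphic_n S g" "z \<in> S"
  shows "cpartial k (\<lambda>z. f z - g z) z = cpartial k f z - cpartial k g z"
  using has_cpartial[OF diff_derivative[OF assms]] by simp

lemma bloch_weight_nonneg: "0 \<le> bloch_weight p f z"
  by (auto simp: bloch_weight_def intro!: sum_nonneg)

lemma bloch_weight_triangle:
  assumes "\<And>k. cmod (cpartial k h z) \<le> cmod (cpartial k f z) + cmod (cpartial k g z)"
  shows "bloch_weight p h z \<le> bloch_weight p f z + bloch_weight p g z"
  unfolding bloch_weight_def sum.distrib[symmetric] distrib_right[symmetric]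
  by (intro sum_mono mult_right_mono assms) auto

lemma bloch_diff:
  assumes "f \<in> bloch p" "g \<in> bloch p"
  shows "(\<lambda>z. f z - g z) \<in> bloch p"
proof -
  have h: "holomorphic_n polydisk f" "holomorphic_n polydisk g"
    using assms by (simp_all add: bloch_def)
  have bdd: "bdd_above (bloch_weight p f ` polydisk)" "bdd_above (bloch_weight p g ` polydisk)"
    using assms by (simp_all add: bloch_def)
  define A where "A = (SUP z\<in>polydisk. bloch_weight p f z)"
  define B where "B = (SUP z\<in>polydisk. bloch_weight p g z)"
  have "bloch_weight p (\<lambda>z. f z - g z) z \<le> A + B" if "z \<in> polydisk" for z
  proof -
    have "bloch_weight p (\<lambda>z. f z - g z) z \<le> bloch_weight p f z + bloch_weight p g z"
      by (rule bloch_weight_triangle) (simp add: cpartial_diff[OF h that] norm_triangle_ineq4)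
    moreover have "bloch_weight p f z \<le> A" "bloch_weight p g z \<le> B"
      unfolding A_def B_def using bdd that by (auto intro: cSUP_upper)
    ultimately show ?thesis by linarith
  qed
  then have "bdd_above (bloch_weight p (\<lambda>z. f z - g z) ` polydisk)"
    by (rule bdd_aboveI2)
  moreover have "holomorphic_n polydisk (\<lambda>z. f z - g z)"
    unfolding holomorphic_n_def by (intro ballI exI) (rule diff_derivative[OF h])
  ultimately show ?thesis
    using assms by (simp add: bloch_def)
qed

lemma bloch_weight_le_SUP:
  assumes "f \<in> bloch p" "z \<in> polydisk"
  shows "bloch_weight p f z \<le> (SUP z\<in>polydisk. bloch_weight p f z)"
  using assms by (auto simp: bloch_def intro: cSUP_upper)

lemma bloch_norm_nonneg:
  assumes "f \<in> bloch p"
  shows "0 \<le> bloch_norm p f"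
  using bloch_weight_le_SUP[OF assms zero_in_polydisk] bloch_weight_nonneg[of p f 0]
  by (simp add: bloch_norm_def)

lemma bloch_norm_zero_iff:
  fixes f :: "complex ^ 'n \<Rightarrow> complex"
  assumes f: "f \<in> bloch p"
  shows "bloch_norm p f = 0 \<longleftrightarrow> f = (\<lambda>z. 0)"
proof
  assume z: "bloch_norm p f = 0"
  have s: "0 \<le> (SUP z\<in>polydisk. bloch_weight p f z)"
    using bloch_weight_le_SUP[OF f zero_in_polydisk] bloch_weight_nonneg[of p f 0] by simp
  then have f0: "f 0 = 0" and sup: "(SUP z\<in>polydisk. bloch_weight p f z) = 0"
    using z unfolding bloch_norm_def
    by (smt (verit) norm_ge_zero norm_eq_zero)+
  have hol: "holomorphic_n polydisk f" and out: "\<And>z. z \<notin> polydisk \<Longrightarrow> f z = 0"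
    using f by (auto simp: bloch_def)
  have "(f has_derivative (\<lambda>h. 0)) (at z within polydisk)" if zU: "z \<in> polydisk" for z
  proof -
    have "bloch_weight p f z = 0"
      using bloch_weight_le_SUP[OF f zU] bloch_weight_nonneg[of p f z] sup by linarith
    then have "\<And>k. cmod (cpartial k f z) * (1 - (cmod (z $ k))\<^sup>2) powr p = 0"
      unfolding bloch_weight_def by (subst (asm) sum_nonneg_eq_0_iff) auto
    moreover have "1 - (cmod (z $ k))\<^sup>2 \<noteq> 0" for k
    proof -
      have "(cmod (z $ k))\<^sup>2 < 1"
        using zU by (simp add: polydisk_def power_less_one_iff)
      then show ?thesis by simp
    qed
    ultimately have "\<And>k. cpartial k f z = 0" by simp
    then show ?thesis
      using holomorphic_n_has_derivative[OF hol zU] by (simp add: has_derivative_at_withinI)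
  qed
  then obtain c where "\<And>z. z \<in> polydisk \<Longrightarrow> f z = c"
    using has_derivative_zero_constant[OF convex_polydisk] by metis
  then show "f = (\<lambda>z. 0)"
    using f0 zero_in_polydisk out by metis
next
  assume "f = (\<lambda>z. 0)"
  moreover have "polydisk \<noteq> ({} :: (complex ^ 'n) set)"
    using zero_in_polydisk by blast
  ultimately show "bloch_norm p f = 0"
    using zero_in_polydisk
    by (simp add: bloch_norm_def bloch_weight_def cpartial_def)
qed

lemma bloch_norm_triangle:
  fixes f g h :: "complex ^ 'n \<Rightarrow> complex"
  assumes f: "f \<in> bloch p" and g: "g \<in> bloch p" and h: "h \<in> bloch p"
  shows "bloch_norm p (\<lambda>z. f z - h z) \<le> bloch_norm p (\<lambda>z. f z - g z) + bloch_norm p (\<lambda>z. g z - h z)"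
proof -
  have hol: "holomorphic_n polydisk f" "holomorphic_n polydisk g" "holomorphic_n polydisk h"
    using assms by (simp_all add: bloch_def)
  let ?W = "\<lambda>f. SUP z\<in>(polydisk :: (complex ^ 'n) set). bloch_weight p f z"
  have "?W (\<lambda>z. f z - h z) \<le> ?W (\<lambda>z. f z - g z) + ?W (\<lambda>z. g z - h z)"
  proof (rule cSUP_least)
    show "(polydisk :: (complex ^ 'n) set) \<noteq> {}" using zero_in_polydisk by blast
    fix z :: "complex ^ 'n" assume z: "z \<in> polydisk"
    have "bloch_weight p (\<lambda>z. f z - h z) z
        \<le> bloch_weight p (\<lambda>z. f z - g z) z + bloch_weight p (\<lambda>z. g z - h z) z"
    proof (rule bloch_weight_triangle)
      fix k
      show "cmod (cpartial k (\<lambda>z. f z - h z) z)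
          \<le> cmod (cpartial k (\<lambda>z. f z - g z) z) + cmod (cpartial k (\<lambda>z. g z - h z) z)"
        unfolding cpartial_diff[OF hol(1,2) z] cpartial_diff[OF hol(2,3) z]
          cpartial_diff[OF hol(1,3) z]
        by (rule norm_diff_triangle_le[OF order_refl order_refl])
    qed
    then show "bloch_weight p (\<lambda>z. f z - h z) z \<le> ?W (\<lambda>z. f z - g z) + ?W (\<lambda>z. g z - h z)"
      using bloch_weight_le_SUP[OF bloch_diff[OF f g] z] bloch_weight_le_SUP[OF bloch_diff[OF g h] z]
      by linarith
  qed
  moreover have "cmod (f 0 - h 0) \<le> cmod (f 0 - g 0) + cmod (g 0 - h 0)"
    by (rule norm_diff_triangle_le[OF order_refl order_refl])
  ultimately show ?thesis
    unfolding bloch_norm_def by linarith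
qed

lemma bloch_norm_commute:
  assumes f: "f \<in> bloch p" and g: "g \<in> bloch p"
  shows "bloch_norm p (\<lambda>z. f z - g z) = bloch_norm p (\<lambda>z. g z - f z)"
proof -
  have hol: "holomorphic_n polydisk f" "holomorphic_n polydisk g"
    using assms by (simp_all add: bloch_def)
  have "bloch_weight p (\<lambda>z. f z - g z) z = bloch_weight p (\<lambda>z. g z - f z) z"
    if "z \<in> polydisk" for z
    unfolding bloch_weight_def cpartial_diff[OF hol that] cpartial_diff[OF hol(2,1) that]
      norm_minus_commute[of "cpartial k f z" "cpartial k g z" for k] by (rule refl)
  then have "(SUP z\<in>polydisk. bloch_weight p (\<lambda>z. f z - g z) z) =
      (SUP z\<in>polydisk. bloch_weight p (\<lambda>z. g z - f z) z)"
    by (rule SUP_cong[OF refl])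
  then show ?thesis
    unfolding bloch_norm_def norm_minus_commute[of "f 0" "g 0"] by (rule arg_cong)
qed

lemma Metric_space_subset_bloch:
  fixes X :: "(complex ^ 'n \<Rightarrow> complex) set"
  assumes "X \<subseteq> bloch p"
  shows "Metric_space X (norm_dist X (bloch_norm p))"
proof
  fix f g :: "complex ^ 'n \<Rightarrow> complex"
  show "0 \<le> norm_dist X (bloch_norm p) f g"
    using assms by (auto simp: norm_dist_def intro!: bloch_norm_nonneg bloch_diff)
  show "norm_dist X (bloch_norm p) f g = norm_dist X (bloch_norm p) g f"
    using assms bloch_norm_commute[of f p g] by (auto simp: norm_dist_def)
next
  fix f g h :: "complex ^ 'n \<Rightarrow> complex"
  assume fg: "f \<in> X" "g \<in> X"
  then have fg': "f \<in> bloch p" "g \<in> bloch p" using assms by auto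
  show "(norm_dist X (bloch_norm p) f g = 0) = (f = g)"
    using fg bloch_norm_zero_iff[OF bloch_diff[OF fg']] by (auto simp: norm_dist_def fun_eq_iff)
  assume "h \<in> X"
  then show "norm_dist X (bloch_norm p) f h
      \<le> norm_dist X (bloch_norm p) f g + norm_dist X (bloch_norm p) g h"
    using fg assms bloch_norm_triangle[OF fg', of h] by (auto simp: norm_dist_def)
qed

lemma little_bloch_subset: "little_bloch p \<subseteq> bloch p"
proof -
  interpret Metric_space "bloch p" "norm_dist (bloch p) (bloch_norm p)"
    by (rule Metric_space_subset_bloch) simp
  show ?thesis
    unfolding little_bloch_def norm_topology_def
    using closure_of_subset_topspace[of mtopology] by simp
qed

end

theory Submission
  imports Defs "HOL-Complex_Analysis.Great_Picard"
begin

text \<open>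
  Sufficiency of the boundary condition: a bounded sequence in the \<open>p\<close>-Bloch space is
  equi-Lipschitz on compact subsets of the polydisk, so by Montel's argument a subsequence converges
  pointwise to a Bloch function \<open>g\<close> with the partial derivatives converging uniformly on compact
  sets. For the images under \<open>C\<^sub>\<phi>\<close> the boundary condition controls the Bloch weight where
  \<open>\<phi>(z)\<close> is near the boundary; elsewhere \<open>\<phi>(z)\<close> stays in a compact set, where the partial
  derivatives converge uniformly, and the coordinates of \<open>\<phi>\<close> are \<open>q\<close>-Bloch functions.
  Hence the images converge to \<open>C\<^sub>\<phi> g\<close> in norm; this limit lies in the little space because the
  latter is closed, although \<open>g\<close> itself may not be a little Bloch function.

  Necessity: a compact \<open>C\<^sub>\<phi>\<close> maps bounded, pointwise null sequences to sequences with norms not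
  bounded away from \<open>0\<close>. Testing with \<open>(1 - |a|\<^sup>2)\<^sup>s / (1 - cnj a w\<^sub>l)\<^sup>N\<close> with
  \<open>s = N + 1 - p > 0\<close> bounds the \<open>l\<close>-th term of the boundary sum where \<open>|\<phi>\<^sub>l(z)|\<close> is near
  \<open>1\<close>; when only another coordinate \<open>\<phi>\<^sub>m(z)\<close> is near the unit circle, test functions in the two
  variables \<open>w\<^sub>m\<close> and \<open>w\<^sub>l\<close> are used.
\<close>

subsection \<open>Bloch functions and closed polydisks\<close>

lemma polydisk_component_bounds:
  assumes "z \<in> polydisk"
  shows "cmod (z $ k) < 1" "0 < 1 - (cmod (z $ k))\<^sup>2" "1 - (cmod (z $ k))\<^sup>2 \<le> 1"
  using assms by (auto simp: polydisk_def power_less_one_iff)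

lemma holomorphic_nI:
  fixes S :: "(complex ^ 'n) set"
  assumes "\<And>z. z \<in> S \<Longrightarrow> (f has_derivative (\<lambda>h. \<Sum>k\<in>UNIV. c z k * h $ k)) (at z)"
  shows "holomorphic_n S f"
  unfolding holomorphic_n_def
proof
  fix z assume "z \<in> S"
  show "\<exists>c :: complex ^ 'n. (f has_derivative (\<lambda>h. \<Sum>k\<in>UNIV. c $ k * h $ k)) (at z)"
    using assms[OF \<open>z \<in> S\<close>] by (intro exI[of _ "\<chi> k. c z k"]) simp
qed

lemma cpartial_eqI:
  assumes "(f has_derivative (\<lambda>h. \<Sum>k\<in>UNIV. c k * h $ k)) (at z)"
  shows "cpartial k f z = c k"
  using has_cpartial[of f "\<chi> k. c k" z k] assms by simp

text \<open>The polydisk is open, so extension by zero changes nothing near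
  \<open>z\<close>.\<close>

lemma zero_ext_has_derivative:
  assumes "(f has_derivative D) (at z)" "z \<in> polydisk"
  shows "(zero_ext f has_derivative D) (at z)"
  by (rule has_derivative_transform_within_open[OF assms(1) open_polydisk assms(2)])
    (simp add: zero_ext_def)

lemma holomorphic_n_zero_ext:
  fixes f :: "complex ^ 'n \<Rightarrow> complex"
  assumes "holomorphic_n polydisk f"
  shows "holomorphic_n polydisk (zero_ext f)"
proof (rule holomorphic_nI)
  fix z :: "complex ^ 'n" assume "z \<in> polydisk"
  then show "(zero_ext f has_derivative (\<lambda>h. \<Sum>k\<in>UNIV. cpartial k f z * h $ k)) (at z)"
    by (intro zero_ext_has_derivative holomorphic_n_has_derivative[OF assms])
qed

lemma cpartial_zero_ext:
  assumes "holomorphic_n polydisk f" "z \<in> polydisk"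
  shows "cpartial k (zero_ext f) z = cpartial k f z"
  by (rule cpartial_eqI, rule zero_ext_has_derivative[OF holomorphic_n_has_derivative[OF assms] assms(2)])

lemma bloch_weight_zero_ext:
  assumes "holomorphic_n polydisk f" "z \<in> polydisk"
  shows "bloch_weight p (zero_ext f) z = bloch_weight p f z"
  by (simp add: bloch_weight_def cpartial_zero_ext[OF assms])

lemma zero_ext_in_bloch:
  assumes "holomorphic_n polydisk f" "\<And>z. z \<in> polydisk \<Longrightarrow> bloch_weight p f z \<le> W"
  shows "zero_ext f \<in> bloch p"
proof -
  have "bdd_above (bloch_weight p (zero_ext f) ` polydisk)"
    using assms by (intro bdd_aboveI2[of _ _ W]) (simp add: bloch_weight_zero_ext)
  then show ?thesis
    using holomorphic_n_zero_ext[OF assms(1)] by (simp add: bloch_def) (simp add: zero_ext_def)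
qed

lemma bloch_norm_le:
  fixes f :: "complex ^ 'n \<Rightarrow> complex"
  assumes "\<And>z. z \<in> polydisk \<Longrightarrow> bloch_weight p f z \<le> W"
  shows "bloch_norm p f \<le> cmod (f 0) + W"
  unfolding bloch_norm_def using zero_in_polydisk assms by (auto intro!: cSUP_least)

lemma bloch_norm_bounds:
  assumes "f \<in> bloch p"
  shows "cmod (f 0) \<le> bloch_norm p f"
    and "z \<in> polydisk \<Longrightarrow> bloch_weight p f z \<le> bloch_norm p f"
proof -
  show "bloch_weight p f z \<le> bloch_norm p f" if "z \<in> polydisk"
    using bloch_weight_le_SUP[OF assms that] by (simp add: bloch_norm_def add_increasing)
  show "cmod (f 0) \<le> bloch_norm p f"
    using bloch_weight_le_SUP[OF assms zero_in_polydisk] bloch_weight_nonneg[of p f 0]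
    by (simp add: bloch_norm_def)
qed

lemma bloch_holomorphic: "f \<in> bloch p \<Longrightarrow> holomorphic_n polydisk f"
  by (simp add: bloch_def)

lemma cpartial_weighted_le:
  "cmod (cpartial k f z) * (1 - (cmod (z $ k))\<^sup>2) powr p \<le> bloch_weight p f z"
  unfolding bloch_weight_def
  by (rule member_le_sum[where f = "\<lambda>k. cmod (cpartial k f z) * (1 - (cmod (z $ k))\<^sup>2) powr p"]) auto

lemma cpartial_le_bloch_norm:
  assumes "f \<in> bloch p" "z \<in> polydisk"
  shows "cmod (cpartial k f z) \<le> bloch_norm p f / (1 - (cmod (z $ k))\<^sup>2) powr p"
proof -
  have "cmod (cpartial k f z) * (1 - (cmod (z $ k))\<^sup>2) powr p \<le> bloch_norm p f"
    using cpartial_weighted_le bloch_norm_bounds(2)[OF assms] by (rule order_trans)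
  then show ?thesis
    using polydisk_component_bounds(2)[OF assms(2), of k] by (simp add: pos_le_divide_eq)
qed

section \<open>Exhaustion by compact convex polydisks, and unweighted estimates on them\<close>

definition closed_polydisk :: "real \<Rightarrow> (complex ^ 'n) set" where
  "closed_polydisk r = {z. \<forall>k. cmod (z $ k) \<le> r}"

lemma closed_polydisk_subset: "r < 1 \<Longrightarrow> closed_polydisk r \<subseteq> polydisk"
  by (auto simp: closed_polydisk_def polydisk_def intro: le_less_trans)

lemma convex_closed_polydisk: "convex (closed_polydisk r :: (complex ^ 'n) set)"
proof -
  have eq: "closed_polydisk r = (\<Inter>k. (\<lambda>z :: complex ^ 'n. z $ k) -` cball 0 r)"
    by (auto simp: closed_polydisk_def)
  have "convex ((\<lambda>z :: complex ^ 'n. z $ k) -` cball 0 r)" for k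
    by (intro convex_linear_vimage convex_cball linear_componentwise bounded_linear.linear
        bounded_linear_vec_nth)
  then show ?thesis unfolding eq by (simp add: convex_INT)
qed

lemma compact_closed_polydisk: "compact (closed_polydisk r :: (complex ^ 'n) set)"
proof -
  have eq: "closed_polydisk r = (\<Inter>k. {z :: complex ^ 'n. cmod (z $ k) \<le> r})"
    by (auto simp: closed_polydisk_def)
  have "closed (closed_polydisk r :: (complex ^ 'n) set)"
    unfolding eq by (auto intro!: closed_INT closed_Collect_le continuous_intros)
  moreover have "norm z \<le> real CARD('n) * r" if "z \<in> closed_polydisk r" for z :: "complex ^ 'n"
  proof -
    have "norm z \<le> (\<Sum>k\<in>UNIV. norm (z $ k))"
      unfolding norm_vec_def by (rule L2_set_le_sum) simp
    also have "\<dots> \<le> (\<Sum>k\<in>(UNIV :: 'n set). r)"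
      using that by (intro sum_mono) (simp add: closed_polydisk_def)
    finally show ?thesis by simp
  qed
  ultimately show ?thesis
    by (auto simp: compact_eq_bounded_closed bounded_iff)
qed

text \<open>Each coordinate modulus attains a maximum below 1 on \<open>K\<close>, and there are
  finitely many coordinates. Including 0 among the bounds keeps the radius nonnegative.\<close>

lemma compact_subset_closed_polydisk:
  fixes K :: "(complex ^ 'n) set"
  assumes "compact K" "K \<subseteq> polydisk"
  obtains r where "0 \<le> r" "r < 1" "K \<subseteq> closed_polydisk r"
proof (cases "K = {}")
  case True
  then show ?thesis using that[of 0] by simp
next
  case False
  have "\<exists>r. r < 1 \<and> (\<forall>z\<in>K. cmod (z $ k) \<le> r)" for k
  proof -
    have "continuous_on K (\<lambda>z. cmod (z $ k))" by (intro continuous_intros)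
    from continuous_attains_sup[OF assms(1) False this]
    obtain x where "x \<in> K" "\<forall>z\<in>K. cmod (z $ k) \<le> cmod (x $ k)" by blast
    then show ?thesis using assms(2) by (auto simp: polydisk_def)
  qed
  then obtain \<rho> where \<rho>: "\<And>k. \<rho> k < 1" "\<And>k z. z \<in> K \<Longrightarrow> cmod (z $ k) \<le> \<rho> k" by metis
  define r where "r = Max (insert 0 (range \<rho>))"
  have "0 \<le> r" "\<And>k. \<rho> k \<le> r"
    unfolding r_def by (auto intro!: Max_ge simp del: Max_insert)
  moreover have "r < 1"
    using \<rho>(1) by (auto simp: r_def)
  ultimately show ?thesis
    using \<rho>(2) by (intro that[of r]) (auto simp: closed_polydisk_def intro: order_trans)
qed

text \<open>The weight is at least \<open>(1 - r\<^sup>2) powr p\<close> on the closed polydisk, so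
  a norm bound turns into a bound that does not depend on the point.\<close>

lemma cpartial_le_on_closed_polydisk:
  assumes "f \<in> bloch p" "bloch_norm p f \<le> M" "0 < p" "0 \<le> r" "r < 1" "z \<in> closed_polydisk r"
  shows "cmod (cpartial k f z) \<le> M / (1 - r\<^sup>2) powr p"
proof -
  have z: "z \<in> polydisk" using assms closed_polydisk_subset by blast
  have le: "(cmod (z $ k))\<^sup>2 \<le> r\<^sup>2"
    using assms(6) by (auto simp: closed_polydisk_def intro!: power_mono)
  have r: "r\<^sup>2 < 1" using assms by (simp add: power_less_one_iff)
  have "bloch_norm p f / (1 - (cmod (z $ k))\<^sup>2) powr p \<le> M / (1 - r\<^sup>2) powr p"
  proof (rule frac_le)
    show "0 \<le> M" using bloch_norm_nonneg[OF assms(1)] assms(2) by linarith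
  qed (use le r assms in \<open>auto intro!: powr_mono2\<close>)
  then show ?thesis using cpartial_le_bloch_norm[OF assms(1) z, of k] by linarith
qed

text \<open>Mean value inequality on a convex set. The constant depends on \<open>f\<close> only
  through \<open>M\<close>, which makes norm-bounded families equi-Lipschitz there.\<close>

lemma bloch_Lipschitz_on_closed_polydisk:
  fixes f :: "complex ^ 'n \<Rightarrow> complex"
  assumes "f \<in> bloch p" "bloch_norm p f \<le> M" "0 < p" "0 \<le> r" "r < 1"
    and "x \<in> closed_polydisk r" "y \<in> closed_polydisk r"
  shows "cmod (f x - f y) \<le> real CARD('n) * (M / (1 - r\<^sup>2) powr p) * norm (x - y)"
proof (rule differentiable_bound[OF convex_closed_polydisk])
  fix z :: "complex ^ 'n" assume z: "z \<in> closed_polydisk r"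
  then have "z \<in> polydisk" using assms closed_polydisk_subset by blast
  then show "(f has_derivative (\<lambda>h. \<Sum>k\<in>UNIV. cpartial k f z * h $ k)) (at z within closed_polydisk r)"
    using holomorphic_n_has_derivative[OF bloch_holomorphic[OF assms(1)]] has_derivative_at_withinI
    by blast
  show "onorm (\<lambda>h. \<Sum>k\<in>UNIV. cpartial k f z * h $ k) \<le> real CARD('n) * (M / (1 - r\<^sup>2) powr p)"
  proof (rule onorm_le)
    fix h :: "complex ^ 'n"
    have "cmod (\<Sum>k\<in>UNIV. cpartial k f z * h $ k) \<le> (\<Sum>k\<in>UNIV. cmod (cpartial k f z) * cmod (h $ k))"
      by (rule norm_sum[THEN order_trans]) (simp add: norm_mult)
    also have "\<dots> \<le> (\<Sum>k\<in>(UNIV::'n set). M / (1 - r\<^sup>2) powr p * norm h)"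
    proof (rule sum_mono)
      fix k
      show "cmod (cpartial k f z) * cmod (h $ k) \<le> M / (1 - r\<^sup>2) powr p * norm h"
        using cpartial_le_on_closed_polydisk[OF assms(1-5) z, of k] order_trans[OF norm_ge_zero cpartial_le_on_closed_polydisk[OF assms(1-5) z, of k]]
        by (intro mult_mono Finite_Cartesian_Product.norm_nth_le) auto
    qed
    finally show "cmod (\<Sum>k\<in>UNIV. cpartial k f z * h $ k)
        \<le> real CARD('n) * (M / (1 - r\<^sup>2) powr p) * norm h" by simp
  qed
qed (use assms in auto)

lemma point_in_closed_polydisk:
  fixes z :: "complex ^ 'n"
  assumes "z \<in> polydisk"
  obtains r where "0 \<le> r" "r < 1" "z \<in> closed_polydisk r"
  using compact_subset_closed_polydisk[of "{z}"] assms by auto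

lemma zero_in_closed_polydisk: "0 \<le> r \<Longrightarrow> 0 \<in> closed_polydisk r"
  by (simp add: closed_polydisk_def)

text \<open>Both \<open>z\<close> and 0 lie in one closed polydisk, where the Lipschitz estimate
  bounds \<open>f z - f 0\<close>. As \<open>C\<close> serves all \<open>f\<close>, norm limits are
  pointwise limits.\<close>

lemma bloch_point_evaluation:
  fixes z :: "complex ^ 'n"
  assumes "0 < p" "z \<in> polydisk"
  obtains C where "0 \<le> C" "\<And>f. f \<in> bloch p \<Longrightarrow> cmod (f z) \<le> C * bloch_norm p f"
proof -
  obtain r where r: "0 \<le> r" "r < 1" "z \<in> closed_polydisk r"
    using point_in_closed_polydisk[OF assms(2)] .
  define C where "C = 1 + real CARD('n) / (1 - r\<^sup>2) powr p * norm z"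
  have "cmod (f z) \<le> C * bloch_norm p f" if f: "f \<in> bloch p" for f
  proof -
    have "cmod (f z - f 0) \<le> real CARD('n) * (bloch_norm p f / (1 - r\<^sup>2) powr p) * norm (z - 0)"
      using r by (intro bloch_Lipschitz_on_closed_polydisk[OF f order_refl assms(1)]
          zero_in_closed_polydisk)
    moreover have "cmod (f z) \<le> cmod (f z - f 0) + cmod (f 0)"
      by (metis diff_add_cancel norm_triangle_ineq)
    ultimately show ?thesis
      using bloch_norm_bounds(1)[OF f] by (simp add: C_def algebra_simps)
  qed
  moreover have "0 \<le> C" by (simp add: C_def)
  ultimately show ?thesis using that by blast
qed

text \<open>Balls of the metric consist of points of the carrier, so approximants come with their
  membership in \<open>bloch p\<close>.\<close>

lemma little_bloch_iff:
  "f \<in> little_bloch p \<longleftrightarrow> f \<in> bloch p \<and>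
     (\<forall>e>0. \<exists>g \<in> zero_ext ` poly_functions. g \<in> bloch p \<and> bloch_norm p (\<lambda>z. f z - g z) < e)"
proof -
  interpret Metric_space "bloch p" "norm_dist (bloch p) (bloch_norm p)"
    by (rule Metric_space_subset_bloch) simp
  show ?thesis
    unfolding little_bloch_def norm_topology_def metric_closure_of by (auto simp: norm_dist_def)
qed

text \<open>Closure is idempotent: approximate twice, each time within \<open>e / 2\<close>. This
  later puts the limit \<open>comp_op \<phi> g\<close> into the little space when \<open>g\<close>
  is only known to be a Bloch function.\<close>

lemma little_bloch_closed:
  assumes f: "f \<in> bloch p"
    and "\<And>e. 0 < e \<Longrightarrow> \<exists>g \<in> little_bloch p. bloch_norm p (\<lambda>z. f z - g z) < e"
  shows "f \<in> little_bloch p"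
  unfolding little_bloch_iff
proof (intro conjI allI impI f)
  fix e :: real assume "0 < e"
  then obtain g where g: "g \<in> little_bloch p" "bloch_norm p (\<lambda>z. f z - g z) < e / 2"
    using assms(2)[of "e/2"] by auto
  then obtain h where h: "h \<in> zero_ext ` poly_functions" "h \<in> bloch p"
    "bloch_norm p (\<lambda>z. g z - h z) < e / 2"
    using \<open>0 < e\<close> unfolding little_bloch_iff[of g] by (metis half_gt_zero)
  have "g \<in> bloch p" using g(1) little_bloch_subset by blast
  from bloch_norm_triangle[OF f this h(2)] g h
  show "\<exists>g\<in>zero_ext ` poly_functions. g \<in> bloch p \<and> bloch_norm p (\<lambda>z. f z - g z) < e"
    by (intro bexI[of _ h]) auto
qed

subsection \<open>Composition and polynomials\<close>

lemma self_map_has_derivative: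
  fixes \<phi> :: "complex ^ 'n \<Rightarrow> complex ^ 'n"
  assumes "holomorphic_self_map \<phi>" "z \<in> polydisk"
  shows "(\<phi> has_derivative (\<lambda>h. \<chi> l. \<Sum>k\<in>UNIV. cpartial k (\<lambda>w. \<phi> w $ l) z * h $ k)) (at z)"
proof (rule has_derivative_componentwise_within[THEN iffD2], rule ballI)
  fix i :: "complex ^ 'n" assume "i \<in> Basis"
  \<comment> \<open>Over the reals, \<open>Basis\<close> consists of the vectors
    \<open>axis l b\<close> with \<open>b\<close> a basis element of \<open>complex\<close>; the
    inner product with such a vector sees only coordinate \<open>l\<close>.\<close>
  then obtain l b where i: "i = axis l b" unfolding Basis_vec_def by blast
  have "holomorphic_n polydisk (\<lambda>z. \<phi> z $ l)"
    using assms(1) by (simp add: holomorphic_self_map_def)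
  from has_derivative_inner_left[OF holomorphic_n_has_derivative[OF this assms(2)], of b]
  show "((\<lambda>x. \<phi> x \<bullet> i) has_derivative
      (\<lambda>x. (\<chi> l. \<Sum>k\<in>UNIV. cpartial k (\<lambda>w. \<phi> w $ l) z * x $ k) \<bullet> i)) (at z)"
    by (simp add: i inner_axis)
qed

lemma self_map_in_polydisk:
  "holomorphic_self_map \<phi> \<Longrightarrow> z \<in> polydisk \<Longrightarrow> \<phi> z \<in> polydisk"
  by (auto simp: holomorphic_self_map_def)

lemma comp_has_derivative:
  fixes \<phi> :: "complex ^ 'n \<Rightarrow> complex ^ 'n"
  assumes "holomorphic_self_map \<phi>" "holomorphic_n polydisk f" "z \<in> polydisk"
  shows "(f \<circ> \<phi> has_derivative (\<lambda>h. \<Sum>k\<in>UNIV.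
           (\<Sum>l\<in>UNIV. cpartial l f (\<phi> z) * cpartial k (\<lambda>w. \<phi> w $ l) z) * h $ k)) (at z)"
proof -
  have "(f has_derivative (\<lambda>h. \<Sum>l\<in>UNIV. cpartial l f (\<phi> z) * h $ l)) (at (\<phi> z))"
    using holomorphic_n_has_derivative[OF assms(2) self_map_in_polydisk[OF assms(1,3)]] .
  from diff_chain_at[OF self_map_has_derivative[OF assms(1,3)] this]
  have "(f \<circ> \<phi> has_derivative (\<lambda>h. \<Sum>l\<in>UNIV. cpartial l f (\<phi> z) *
      (\<Sum>k\<in>UNIV. cpartial k (\<lambda>w. \<phi> w $ l) z * h $ k))) (at z)"
    by (simp add: o_def)
  moreover have "(\<lambda>h. \<Sum>l\<in>UNIV. cpartial l f (\<phi> z) * (\<Sum>k\<in>UNIV. cpartial k (\<lambda>w. \<phi> w $ l) z * h $ k))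
     = (\<lambda>h. \<Sum>k\<in>UNIV. (\<Sum>l\<in>UNIV. cpartial l f (\<phi> z) * cpartial k (\<lambda>w. \<phi> w $ l) z) * h $ k)"
    unfolding sum_distrib_left sum_distrib_right
    by (subst sum.swap) (simp add: mult.assoc)
  ultimately show ?thesis by simp
qed

lemma holomorphic_n_comp:
  fixes \<phi> :: "complex ^ 'n \<Rightarrow> complex ^ 'n"
  assumes "holomorphic_self_map \<phi>" "holomorphic_n polydisk f"
  shows "holomorphic_n polydisk (f \<circ> \<phi>)"
  by (rule holomorphic_nI) (rule comp_has_derivative[OF assms])

lemma cpartial_comp_op:
  fixes \<phi> :: "complex ^ 'n \<Rightarrow> complex ^ 'n"
  assumes "holomorphic_self_map \<phi>" "holomorphic_n polydisk f" "z \<in> polydisk"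
  shows "cpartial k (comp_op \<phi> f) z = (\<Sum>l\<in>UNIV. cpartial l f (\<phi> z) * cpartial k (\<lambda>w. \<phi> w $ l) z)"
  unfolding comp_op_def
  by (rule cpartial_eqI, rule zero_ext_has_derivative[OF comp_has_derivative[OF assms] assms(3)])

section \<open>Polynomial functions\<close>

lemma poly_functions_monomial:
  "(\<lambda>z. a * (\<Prod>k\<in>UNIV. (z $ k) ^ \<gamma> k)) \<in> poly_functions"
  unfolding poly_functions_def by (intro CollectI exI[of _ "{\<gamma>}"] exI[of _ "\<lambda>_. a"]) simp

lemma poly_functions_add:
  assumes "f \<in> poly_functions" "g \<in> poly_functions"
  shows "(\<lambda>z. f z + g z) \<in> poly_functions"
proof -
  let ?mon = "\<lambda>z \<gamma>. \<Prod>k\<in>UNIV. (z $ k) ^ \<gamma> k :: complex"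
  obtain A a B b where A: "finite A" "f = (\<lambda>z. \<Sum>\<gamma>\<in>A. a \<gamma> * ?mon z \<gamma>)"
    and B: "finite B" "g = (\<lambda>z. \<Sum>\<gamma>\<in>B. b \<gamma> * ?mon z \<gamma>)"
    using assms unfolding poly_functions_def by blast
  \<comment> \<open>Extending both coefficient families by zero brings the sums to the common index
    set \<open>A \<union> B\<close>.\<close>
  have "(\<Sum>\<gamma>\<in>A. a \<gamma> * ?mon z \<gamma>) = (\<Sum>\<gamma>\<in>A \<union> B. (if \<gamma> \<in> A then a \<gamma> else 0) * ?mon z \<gamma>)"
    "(\<Sum>\<gamma>\<in>B. b \<gamma> * ?mon z \<gamma>) = (\<Sum>\<gamma>\<in>A \<union> B. (if \<gamma> \<in> B then b \<gamma> else 0) * ?mon z \<gamma>)" for z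
    using A(1) B(1) by (auto intro!: sum.mono_neutral_cong_left)
  then have eq: "(\<lambda>z. f z + g z) =
      (\<lambda>z. \<Sum>\<gamma>\<in>A \<union> B. ((if \<gamma> \<in> A then a \<gamma> else 0) + (if \<gamma> \<in> B then b \<gamma> else 0)) * ?mon z \<gamma>)"
    unfolding A(2) B(2) distrib_right sum.distrib by metis
  have "finite (A \<union> B)" using A(1) B(1) by simp
  then show ?thesis
    unfolding poly_functions_def mem_Collect_eq by (intro exI conjI) (assumption, rule eq)
qed

lemma poly_functions_sum:
  assumes "\<And>i. i \<in> I \<Longrightarrow> f i \<in> poly_functions"
  shows "(\<lambda>z. \<Sum>i\<in>I. f i z) \<in> poly_functions"
  using assms
proof (induction I rule: infinite_finite_induct)
  case (insert i I)
  then show ?case using poly_functions_add[of "f i" "\<lambda>z. \<Sum>i\<in>I. f i z"] by simp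
qed (use poly_functions_monomial[of 0] in auto)

text \<open>The exponents belonging to \<open>m\<close> and \<open>l\<close> are added
  coordinatewise, so the case \<open>m = l\<close> is included.\<close>

lemma poly_functions_two_variables:
  "(\<lambda>z. (\<Sum>i<N. a i * (z $ m) ^ i) * (c + d * z $ l)) \<in> poly_functions"
proof -
  have m: "(\<Prod>k\<in>UNIV. (z $ k) ^ (if k = m then i else 0)) = (z $ m) ^ i" for z :: "complex ^ 'a" and m i
    by (simp add: if_distrib prod.delta cong: if_cong)
  have "(\<Prod>k\<in>UNIV. (z $ k) ^ ((if k = m then i else 0) + (if k = l then 1 else 0))) = (z $ m) ^ i * z $ l"
    for z :: "complex ^ 'a" and i
    unfolding power_add prod.distrib m by simp
  then have "(\<lambda>z. (\<Sum>i<N. a i * (z $ m) ^ i) * (c + d * z $ l)) =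
     (\<lambda>z. (\<Sum>i<N. (a i * c) * (\<Prod>k\<in>UNIV. (z $ k) ^ (if k = m then i else 0)) +
        (a i * d) * (\<Prod>k\<in>UNIV. (z $ k) ^ ((if k = m then i else 0) + (if k = l then 1 else 0)))))"
    unfolding m by (simp add: sum_distrib_right sum_distrib_left sum.distrib algebra_simps)
  also have "\<dots> \<in> poly_functions"
    by (intro poly_functions_sum poly_functions_add poly_functions_monomial)
  finally show ?thesis .
qed

text \<open>On the polydisk the k-th partial derivative has modulus at most
  \<open>\<gamma> k\<close> and the weights are at most 1, which gives a Bloch function; as a
  polynomial it is its own approximant.\<close>

lemma monomial_in_little_bloch:
  fixes \<gamma> :: "'n::finite \<Rightarrow> nat"
  assumes "0 < p"
  shows "zero_ext (\<lambda>z. \<Prod>k\<in>UNIV. (z $ k) ^ \<gamma> k) \<in> little_bloch p"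
proof -
  let ?f = "\<lambda>z :: complex ^ 'n. \<Prod>k\<in>UNIV. (z $ k) ^ \<gamma> k"
  \<comment> \<open>For \<open>\<gamma> k = 0\<close> the truncated exponent
    \<open>\<gamma> k - 1\<close> is harmless because the factor \<open>of_nat (\<gamma> k)\<close>
    vanishes.\<close>
  define D where "D z k = of_nat (\<gamma> k) * (z $ k) ^ (\<gamma> k - 1) * (\<Prod>j\<in>UNIV - {k}. (z $ j) ^ \<gamma> j)"
    for z :: "complex ^ 'n" and k
  have D: "(?f has_derivative (\<lambda>h. \<Sum>k\<in>UNIV. D z k * h $ k)) (at z)" for z
  proof -
    have "((\<lambda>z. (z $ k) ^ \<gamma> k) has_derivative
        (\<lambda>h. of_nat (\<gamma> k) * h $ k * (z $ k) ^ (\<gamma> k - 1))) (at z)" for k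
      by (auto intro!: derivative_eq_intros bounded_linear_imp_has_derivative bounded_linear_vec_nth)
    from has_derivative_prod[where I = UNIV, OF this]
    show ?thesis
      by (rule has_derivative_eq_rhs) (auto simp: D_def algebra_simps)
  qed
  have "bloch_weight p ?f z \<le> (\<Sum>k\<in>UNIV. real (\<gamma> k))" if z: "z \<in> polydisk" for z
    unfolding bloch_weight_def
  proof (rule sum_mono)
    fix k
    have le1: "cmod (z $ j) ^ i \<le> 1" for j i
      using polydisk_component_bounds(1)[OF z, of j] by (simp add: power_le_one)
    have "cmod (D z k) \<le> real (\<gamma> k) * 1 * 1"
      unfolding D_def norm_mult norm_power prod_norm[symmetric] norm_of_nat
      by (intro mult_mono prod_le_1) (auto simp: le1 prod_nonneg)
    moreover have "(1 - (cmod (z $ k))\<^sup>2) powr p \<le> 1"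
      using polydisk_component_bounds[OF z, of k] assms by (intro powr_le1) auto
    ultimately show "cmod (cpartial k ?f z) * (1 - (cmod (z $ k))\<^sup>2) powr p \<le> real (\<gamma> k)"
      unfolding cpartial_eqI[OF D] using mult_mono[of "cmod (D z k)" "real (\<gamma> k)" _ 1] by simp
  qed
  then have "zero_ext ?f \<in> bloch p"
    by (intro zero_ext_in_bloch holomorphic_nI[OF D])
  moreover have "?f \<in> poly_functions"
    using poly_functions_monomial[of 1 \<gamma>] by simp
  moreover have "bloch_norm p (\<lambda>z. zero_ext ?f z - zero_ext ?f z) = 0"
    using bloch_norm_zero_iff[OF bloch_diff, of "zero_ext ?f" p "zero_ext ?f"] calculation by simp
  ultimately show ?thesis
    unfolding little_bloch_iff by auto
qed

subsection \<open>Test functions\<close>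

text \<open>Partial sums of the power series of \<open>deriv F\<close> converge uniformly on the
  closed unit disk. Their primitives with value \<open>F 0\<close> at 0 approximate \<open>F\<close>
  by the mean value inequality, since \<open>cmod w \<le> 1\<close>. Starting from the derivative
  yields both estimates at once.\<close>

lemma holomorphic_polynomial_approximation:
  assumes "F holomorphic_on ball 0 R" "1 < R" "0 < e"
  obtains a N where
    "\<And>w. cmod w \<le> 1 \<Longrightarrow> cmod (F w - (\<Sum>i<N. a i * w ^ i)) \<le> e"
    "\<And>w. cmod w \<le> 1 \<Longrightarrow> cmod (deriv F w - deriv (\<lambda>w. \<Sum>i<N. a i * w ^ i) w) \<le> e"
proof -
  define b where "b i = (deriv ^^ i) (deriv F) 0 / fact i" for i
  have holF': "deriv F holomorphic_on ball 0 R"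
    by (rule holomorphic_deriv[OF assms(1)]) simp
  have sums: "(\<lambda>i. b i * w ^ i) sums deriv F w" if "cmod w < R" for w
    using holomorphic_power_series[OF holF', of w] that by (simp add: b_def)
  \<comment> \<open>The series converges at a point of modulus \<open>r > 1\<close>, so its radius
    of convergence exceeds 1 and convergence is uniform on the closed unit disk.\<close>
  define r where "r = (1 + R) / 2"
  have r: "1 < r" "r < R" using assms(2) by (auto simp: r_def field_simps)
  have "summable (\<lambda>i. b i * (of_real r) ^ i)"
    using sums[of "of_real r"] r by (auto simp: sums_iff)
  from conv_radius_geI[OF this] have "ereal 1 < conv_radius b"
    using r by (auto elim: less_le_trans[rotated])
  from powser_uniform_limit[OF this, of 0]
  have "uniform_limit (cball 0 1) (\<lambda>n x. \<Sum>i<n. b i * x ^ i) (\<lambda>x. \<Sum>i. b i * x ^ i) sequentially"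
    by simp
  from uniform_limitD[OF this assms(3)] obtain N
    where N: "\<And>w. w \<in> cball 0 1 \<Longrightarrow> dist (\<Sum>i<N. b i * w ^ i) (\<Sum>i. b i * w ^ i) < e"
    unfolding eventually_sequentially by blast
  \<comment> \<open>Coefficients of the primitive; integration raises degrees by one, hence
    \<open>Suc N\<close> terms in \<open>P\<close>.\<close>
  define a where "a i = (case i of 0 \<Rightarrow> F 0 | Suc j \<Rightarrow> b j / of_nat (Suc j))" for i
  define P where "P w = (\<Sum>i<Suc N. a i * w ^ i)" for w
  have P: "P w = F 0 + (\<Sum>i<N. b i / of_nat (Suc i) * w ^ Suc i)" for w
    unfolding P_def sum.lessThan_Suc_shift by (simp add: a_def)
  have dP: "(P has_field_derivative (\<Sum>i<N. b i * w ^ i)) (at w)" for w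
  proof -
    have 1: "((\<lambda>w. w ^ Suc i) has_field_derivative of_nat (Suc i) * w ^ i) (at w)" for i
      by (rule DERIV_cong[OF DERIV_power[OF DERIV_ident]]) simp
    have "((\<lambda>w. b i / of_nat (Suc i) * w ^ Suc i) has_field_derivative b i * w ^ i) (at w)" for i
      using DERIV_cmult[OF 1, of "b i / of_nat (Suc i)" i] by (simp del: of_nat_Suc power_Suc)
    from DERIV_add[OF DERIV_const[of "F 0"] DERIV_sum[OF this]]
    show ?thesis unfolding P[abs_def] by simp
  qed
  have dF: "(F has_field_derivative deriv F w) (at w)" if "cmod w < R" for w
    using holomorphic_derivI[OF assms(1)] that by simp
  have d: "cmod (deriv F w - (\<Sum>i<N. b i * w ^ i)) \<le> e" if "cmod w \<le> 1" for w
    using N[of w] sums[of w] that assms(2) by (simp add: sums_iff dist_norm norm_minus_commute)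
  have "cmod ((F w - P w) - (F 0 - P 0)) \<le> e * cmod (w - 0)" if "cmod w \<le> 1" for w
  proof (rule field_differentiable_bound[OF convex_cball[of 0 1]])
    show "((\<lambda>w. F w - P w) has_field_derivative deriv F z - (\<Sum>i<N. b i * z ^ i)) (at z within cball 0 1)"
      if "z \<in> cball 0 1" for z
      using that assms(2) by (intro DERIV_diff DERIV_subset[OF dF] DERIV_subset[OF dP]) auto
  qed (use that d in auto)
  moreover have "P 0 = F 0" by (simp add: P)
  moreover have "e * cmod w \<le> e" if "cmod w \<le> 1" for w
    using that assms(3) by simp
  ultimately have "cmod (F w - P w) \<le> e" if "cmod w \<le> 1" for w
    using that by fastforce
  moreover have "deriv P w = (\<Sum>i<N. b i * w ^ i)" for w
    using dP by (rule DERIV_imp_deriv)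
  ultimately show ?thesis
    using that[of a "Suc N"] d unfolding P_def[abs_def] by simp
qed

section \<open>Test functions: a function of one coordinate times an affine function of
  another\<close>

text \<open>Two choices serve as test functions: \<open>c = 1\<close>, \<open>d = 0\<close> leaves a
  function of one coordinate, and \<open>c = - b\<close>, \<open>d = 1\<close> gives a factor that
  vanishes where \<open>z $ l = b\<close>.\<close>

definition two_variable_fun ::
    "(complex \<Rightarrow> complex) \<Rightarrow> 'n \<Rightarrow> complex \<Rightarrow> complex \<Rightarrow> 'n \<Rightarrow> complex ^ 'n \<Rightarrow> complex" where
  "two_variable_fun F m c d l = (\<lambda>z. F (z $ m) * (c + d * z $ l))"

text \<open>Both contributions enter as added conditional terms, so \<open>m = l\<close> is covered
  and yields the product rule in a single coordinate.\<close>

lemma two_variable_fun_has_derivative: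
  fixes z :: "complex ^ 'n"
  assumes "(F has_field_derivative F') (at (z $ m))"
  shows "(two_variable_fun F m c d l has_derivative
     (\<lambda>h. \<Sum>k\<in>UNIV. ((if k = m then F' * (c + d * z $ l) else 0) +
        (if k = l then F (z $ m) * d else 0)) * h $ k)) (at z)"
proof -
  have "((\<lambda>z :: complex ^ 'n. z $ m) has_derivative (\<lambda>h. h $ m)) (at z)" for m
    by (intro bounded_linear_imp_has_derivative bounded_linear_vec_nth)
  note nth = this
  have "((\<lambda>z :: complex ^ 'n. F (z $ m)) has_derivative (\<lambda>h. F' * h $ m)) (at z)"
    using has_derivative_compose[OF nth assms[unfolded has_field_derivative_def]] .
  from has_derivative_mult[OF this has_derivative_add[OF has_derivative_const[of c]
        has_derivative_mult_right[OF nth[of l], of d]]]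
  show ?thesis
    unfolding two_variable_fun_def
    by (rule has_derivative_eq_rhs)
      (simp add: fun_eq_iff distrib_right sum.distrib mult_delta_left, simp add: algebra_simps)
qed

text \<open>The derivative of \<open>F\<close> may be large near the unit circle and keeps its
  weight; in the term with \<open>F\<close> itself the weight is merely bounded by 1.\<close>

lemma bloch_weight_two_variable_fun:
  fixes z :: "complex ^ 'n"
  assumes "(F has_field_derivative F') (at (z $ m))" "0 < p" "z \<in> polydisk"
  shows "bloch_weight p (two_variable_fun F m c d l) z
    \<le> cmod F' * (1 - (cmod (z $ m))\<^sup>2) powr p * (cmod c + cmod d) + cmod (F (z $ m)) * cmod d"
proof -
  define w where "w k = (1 - (cmod (z $ k))\<^sup>2) powr p" for k
  have w: "0 \<le> w k" "w k \<le> 1" for k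
    using polydisk_component_bounds[OF assms(3), of k] assms(2) by (auto simp: w_def intro!: powr_le1)
  have cd: "cmod (c + d * z $ l) \<le> cmod c + cmod d"
    using polydisk_component_bounds(1)[OF assms(3), of l]
    by (intro norm_triangle_le) (simp add: norm_mult mult_left_le)
  have "bloch_weight p (two_variable_fun F m c d l) z =
    (\<Sum>k\<in>UNIV. cmod ((if k = m then F' * (c + d * z $ l) else 0) + (if k = l then F (z $ m) * d else 0)) * w k)"
    unfolding bloch_weight_def cpartial_eqI[OF two_variable_fun_has_derivative[OF assms(1)]] w_def ..
  also have "\<dots> \<le> (\<Sum>k\<in>UNIV. (if k = m then cmod F' * (cmod c + cmod d) * w k else 0) +
      (if k = l then cmod (F (z $ m)) * cmod d else 0))"
  proof (rule sum_mono)
    fix k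
    have "cmod ((if k = m then F' * (c + d * z $ l) else 0) + (if k = l then F (z $ m) * d else 0)) * w k
       \<le> (cmod (if k = m then F' * (c + d * z $ l) else 0) +
          cmod (if k = l then F (z $ m) * d else 0)) * w k"
      by (intro mult_right_mono norm_triangle_ineq w)
    also have "\<dots> = cmod (if k = m then F' * (c + d * z $ l) else 0) * w k +
          cmod (if k = l then F (z $ m) * d else 0) * w k"
      by (rule distrib_right)
    also have "\<dots> \<le> (if k = m then cmod F' * (cmod c + cmod d) * w k else 0) +
      (if k = l then cmod (F (z $ m)) * cmod d else 0)"
    proof (rule add_mono)
      show "cmod (if k = m then F' * (c + d * z $ l) else 0) * w k
          \<le> (if k = m then cmod F' * (cmod c + cmod d) * w k else 0)"
        using cd w by (auto simp: norm_mult intro!: mult_right_mono mult_left_mono)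
      show "cmod (if k = l then F (z $ m) * d else 0) * w k
          \<le> (if k = l then cmod (F (z $ m)) * cmod d else 0)"
        using w[of k] by (auto simp: norm_mult mult_left_le)
    qed
    finally show "cmod ((if k = m then F' * (c + d * z $ l) else 0) + (if k = l then F (z $ m) * d else 0)) * w k
       \<le> (if k = m then cmod F' * (cmod c + cmod d) * w k else 0) +
      (if k = l then cmod (F (z $ m)) * cmod d else 0)" .
  qed
  also have "\<dots> = cmod F' * w m * (cmod c + cmod d) + cmod (F (z $ m)) * cmod d"
    by (simp add: sum.distrib)
  finally show ?thesis by (simp add: w_def)
qed

lemma holomorphic_n_two_variable_fun:
  fixes m :: "'n::finite"
  assumes "F holomorphic_on ball 0 R" "1 \<le> R"
  shows "holomorphic_n polydisk (two_variable_fun F m c d l)"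
proof (rule holomorphic_nI)
  fix z :: "complex ^ 'n" assume z: "z \<in> polydisk"
  then have "(F has_field_derivative deriv F (z $ m)) (at (z $ m))"
    using polydisk_component_bounds(1)[OF z, of m] assms by (intro holomorphic_derivI[OF assms(1)]) auto
  then show "(two_variable_fun F m c d l has_derivative
     (\<lambda>h. \<Sum>k\<in>UNIV. ((if k = m then deriv F (z $ m) * (c + d * z $ l) else 0) +
        (if k = l then F (z $ m) * d else 0)) * h $ k)) (at z)"
    by (rule two_variable_fun_has_derivative)
qed

text \<open>\<open>F\<close> is bounded only through its product with \<open>cmod d\<close>: for
  \<open>d = 0\<close> the choice \<open>B = 0\<close> serves families of kernels that have no
  common bound.\<close>

lemma bloch_two_variable_fun:
  fixes m :: "'n::finite"
  assumes "F holomorphic_on ball 0 R" "1 \<le> R" "0 < p"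
    and A: "\<And>w. cmod w < 1 \<Longrightarrow> cmod (deriv F w) * (1 - (cmod w)\<^sup>2) powr p \<le> A"
    and B: "\<And>w. cmod w < 1 \<Longrightarrow> cmod (F w) * cmod d \<le> B"
  shows "zero_ext (two_variable_fun F m c d l) \<in> bloch p"
    and "bloch_norm p (zero_ext (two_variable_fun F m c d l))
      \<le> cmod (F 0) * cmod c + (A * (cmod c + cmod d) + B)"
proof -
  have hol: "holomorphic_n polydisk (two_variable_fun F m c d l)"
    by (rule holomorphic_n_two_variable_fun[OF assms(1,2)])
  have bw: "bloch_weight p (two_variable_fun F m c d l) z \<le> A * (cmod c + cmod d) + B"
    if z: "z \<in> polydisk" for z
  proof -
    note zm = polydisk_component_bounds(1)[OF z, of m]
    then have "(F has_field_derivative deriv F (z $ m)) (at (z $ m))"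
      using assms by (intro holomorphic_derivI[OF assms(1)]) auto
    from bloch_weight_two_variable_fun[OF this assms(3) z, of c d l]
    have "bloch_weight p (two_variable_fun F m c d l) z \<le>
      cmod (deriv F (z $ m)) * (1 - (cmod (z $ m))\<^sup>2) powr p * (cmod c + cmod d) +
      cmod (F (z $ m)) * cmod d" .
    also have "\<dots> \<le> A * (cmod c + cmod d) + B"
      by (intro add_mono mult_right_mono A B zm) auto
    finally show ?thesis .
  qed
  show "zero_ext (two_variable_fun F m c d l) \<in> bloch p"
    using hol bw by (rule zero_ext_in_bloch)
  have "bloch_norm p (zero_ext (two_variable_fun F m c d l))
    \<le> cmod (zero_ext (two_variable_fun F m c d l) 0) + (A * (cmod c + cmod d) + B)"
    by (rule bloch_norm_le) (simp add: bloch_weight_zero_ext[OF hol] bw)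
  then show "bloch_norm p (zero_ext (two_variable_fun F m c d l))
      \<le> cmod (F 0) * cmod c + (A * (cmod c + cmod d) + B)"
    by (simp add: zero_ext_def two_variable_fun_def norm_mult zero_in_polydisk)
qed

text \<open>Since \<open>F\<close> is holomorphic beyond the closed unit disk, polynomials
  approximate \<open>F\<close> and \<open>deriv F\<close> uniformly there, and these two suprema
  control the Bloch norm of the product.\<close>

lemma two_variable_fun_in_little_bloch:
  fixes m :: "'n::finite"
  assumes F: "F holomorphic_on ball 0 R" "1 < R" and p: "0 < p"
  shows "zero_ext (two_variable_fun F m c d l) \<in> little_bloch p"
proof -
  define K where "K = cmod c + cmod d"
  have K: "0 \<le> K" "cmod c \<le> K" "cmod d \<le> K" by (auto simp: K_def)
  have weight_le1: "(1 - (cmod w)\<^sup>2) powr p \<le> 1" "0 \<le> (1 - (cmod w)\<^sup>2) powr p" if "cmod w < 1" for w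
    using that p by (auto intro!: powr_le1 simp: power_le_one)
  \<comment> \<open>The factor 3 counts the value at 0, the term with \<open>deriv G\<close> and the
    term with \<open>G\<close>, each at most \<open>e * K\<close>.\<close>
  have small: "zero_ext (two_variable_fun G m c d l) \<in> bloch p"
    "bloch_norm p (zero_ext (two_variable_fun G m c d l)) \<le> 3 * e * K"
    if G: "G holomorphic_on ball 0 R" and e: "\<And>w. cmod w \<le> 1 \<Longrightarrow> cmod (G w) \<le> e"
      "\<And>w. cmod w \<le> 1 \<Longrightarrow> cmod (deriv G w) \<le> e" for G e
  proof -
    have "0 \<le> e" using order_trans[OF norm_ge_zero e(1)[of 0]] by simp
    have A: "cmod (deriv G w) * (1 - (cmod w)\<^sup>2) powr p \<le> e" if "cmod w < 1" for w
      using mult_mono[OF e(2)[of w] weight_le1(1)[OF that] \<open>0 \<le> e\<close> weight_le1(2)[OF that]] that by simp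
    have B: "cmod (G w) * cmod d \<le> e * K" if "cmod w < 1" for w
      using that K \<open>0 \<le> e\<close> by (intro mult_mono e) auto
    note b = bloch_two_variable_fun[OF G less_imp_le[OF F(2)] p A B, where m = m and l = l and c = c]
    show "zero_ext (two_variable_fun G m c d l) \<in> bloch p" by (rule b(1))
    have "cmod (G 0) * cmod c \<le> e * K"
      using K \<open>0 \<le> e\<close> by (intro mult_mono e) auto
    with b(2) show "bloch_norm p (zero_ext (two_variable_fun G m c d l)) \<le> 3 * e * K"
      by (simp add: K_def algebra_simps)
  qed
  have in_bloch: "zero_ext (two_variable_fun G m c d l) \<in> bloch p"
    if G: "G holomorphic_on ball 0 R" for G
  proof -
    have "cball 0 1 \<subseteq> ball 0 R" using F(2) by (auto simp: dist_norm)
    then have "continuous_on (cball 0 1) G" "continuous_on (cball 0 1) (deriv G)"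
      using G holomorphic_deriv[OF G open_ball]
      by (auto intro: holomorphic_on_imp_continuous_on holomorphic_on_subset)
    then have "compact (G ` cball 0 1 \<union> deriv G ` cball 0 1)"
      by (intro compact_Un compact_continuous_image compact_cball)
    then obtain e where "\<And>w. w \<in> G ` cball 0 1 \<union> deriv G ` cball 0 1 \<Longrightarrow> cmod w \<le> e"
      using compact_imp_bounded bounded_iff by metis
    then show ?thesis by (intro small(1)[OF G, of e]) auto
  qed
  show ?thesis
    unfolding little_bloch_iff
  proof (intro conjI allI impI in_bloch F)
    fix e :: real assume "0 < e"
    \<comment> \<open>The summand 1 covers \<open>K = 0\<close>.\<close>
    define e' where "e' = e / (3 * K + 1)"
    have e': "0 < e'" "3 * e' * K < e"
      using \<open>0 < e\<close> K by (auto simp: e'_def divide_simps algebra_simps)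
    obtain a N where aN: "\<And>w. cmod w \<le> 1 \<Longrightarrow> cmod (F w - (\<Sum>i<N. a i * w ^ i)) \<le> e'"
      "\<And>w. cmod w \<le> 1 \<Longrightarrow> cmod (deriv F w - deriv (\<lambda>w. \<Sum>i<N. a i * w ^ i) w) \<le> e'"
      using holomorphic_polynomial_approximation[OF F e'(1)] by blast
    define P where "P w = (\<Sum>i<N. a i * w ^ i)" for w
    have hP: "P holomorphic_on ball 0 R"
      unfolding P_def by (intro holomorphic_intros)
    have d: "deriv (\<lambda>w. F w - P w) w = deriv F w - deriv P w" if "cmod w \<le> 1" for w
      using that F hP by (intro deriv_diff holomorphic_on_imp_differentiable_at[OF _ open_ball]) auto
    have "bloch_norm p (zero_ext (two_variable_fun (\<lambda>w. F w - P w) m c d l)) \<le> 3 * e' * K"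
      using aN by (intro small(2) holomorphic_on_diff F hP) (auto simp: d[unfolded P_def] P_def)
    moreover have "(\<lambda>z. zero_ext (two_variable_fun F m c d l) z - zero_ext (two_variable_fun P m c d l) z)
       = zero_ext (two_variable_fun (\<lambda>w. F w - P w) m c d l)"
      by (auto simp: zero_ext_def two_variable_fun_def algebra_simps)
    moreover have "two_variable_fun P m c d l \<in> poly_functions"
      unfolding two_variable_fun_def P_def by (rule poly_functions_two_variables)
    ultimately show "\<exists>g\<in>zero_ext ` poly_functions. g \<in> bloch p \<and>
        bloch_norm p (\<lambda>z. zero_ext (two_variable_fun F m c d l) z - g z) < e"
      using in_bloch[OF hP] e' by (intro bexI[of _ "zero_ext (two_variable_fun P m c d l)"]) auto
  qed
qed

section \<open>Kernel functions of one variable\<close>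

text \<open>For \<open>0 < cmod a < 1\<close> the pole \<open>1 / cnj a\<close> lies outside the
  closed unit disk. The numerator is a normalisation: for \<open>s = real N + 1 - p > 0\<close> the
  p-Bloch norms stay bounded as \<open>a\<close> tends to the unit circle.\<close>

definition bloch_kernel :: "real \<Rightarrow> nat \<Rightarrow> complex \<Rightarrow> complex \<Rightarrow> complex" where
  "bloch_kernel s N a w = of_real ((1 - (cmod a)\<^sup>2) powr s) / (1 - cnj a * w) ^ N"

text \<open>The modulus is at least \<open>1 - cmod a * cmod w\<close>, hence at least the distance
  of either point to the circle; the squared forms follow from
  \<open>1 - x\<^sup>2 \<le> 2 * (1 - x)\<close>.\<close>

lemma one_minus_cnj_mult_ge:
  assumes "cmod a < 1" "cmod w < 1"
  shows "1 - cmod a \<le> cmod (1 - cnj a * w)" "1 - cmod w \<le> cmod (1 - cnj a * w)"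
    "1 - (cmod a)\<^sup>2 \<le> 2 * cmod (1 - cnj a * w)" "1 - (cmod w)\<^sup>2 \<le> 2 * cmod (1 - cnj a * w)"
    "1 - cnj a * w \<noteq> 0"
proof -
  have sq: "1 - x\<^sup>2 \<le> 2 * (1 - x)" for x :: real
    using zero_le_power2[of "1 - x"] by (simp add: power2_eq_square algebra_simps)
  have m: "cmod a * cmod w \<le> cmod a" "cmod a * cmod w \<le> cmod w"
    using assms by (simp_all add: mult_left_le mult_left_le_one_le)
  have "1 - cmod a * cmod w \<le> cmod (1 - cnj a * w)"
    using norm_triangle_ineq2[of 1 "cnj a * w"] by (simp add: norm_mult)
  with m show 1: "1 - cmod a \<le> cmod (1 - cnj a * w)" "1 - cmod w \<le> cmod (1 - cnj a * w)" by linarith+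
  show "1 - (cmod a)\<^sup>2 \<le> 2 * cmod (1 - cnj a * w)" 
    by (rule order_trans[OF sq mult_left_mono[OF 1(1)]]) simp
  show "1 - (cmod w)\<^sup>2 \<le> 2 * cmod (1 - cnj a * w)" 
    by (rule order_trans[OF sq mult_left_mono[OF 1(2)]]) simp
  show "1 - cnj a * w \<noteq> 0" using 1 assms by auto
qed

lemma bloch_kernel_has_derivative:
  assumes "1 - cnj a * w \<noteq> 0"
  shows "(bloch_kernel s N a has_field_derivative
    of_real ((1 - (cmod a)\<^sup>2) powr s) * of_nat N * cnj a / (1 - cnj a * w) ^ Suc N) (at w)"
proof -
  let ?c = "of_real ((1 - (cmod a)\<^sup>2) powr s) :: complex"
  have "((\<lambda>w. inverse (1 - cnj a * w)) has_field_derivative cnj a * inverse (1 - cnj a * w) ^ 2) (at w)"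
    using assms by (auto intro!: derivative_eq_intros simp: power2_eq_square)
  from DERIV_cmult[OF DERIV_power[OF this, of N], of ?c]
  have "((\<lambda>w. ?c * inverse (1 - cnj a * w) ^ N) has_field_derivative
      ?c * (of_nat N * (cnj a * inverse (1 - cnj a * w) ^ 2 * inverse (1 - cnj a * w) ^ (N - Suc 0)))) (at w)" .
  \<comment> \<open>For \<open>N = 0\<close> both sides vanish; the case is split off because
    \<open>N - Suc 0\<close> is truncated.\<close>
  moreover have "?c * (of_nat N * (cnj a * x ^ 2 * x ^ (N - Suc 0))) = ?c * of_nat N * cnj a * x ^ Suc N"
    for x :: complex
    by (cases N) (simp_all add: power2_eq_square)
  moreover have "bloch_kernel s N a = (\<lambda>w. ?c * inverse (1 - cnj a * w) ^ N)"
    by (auto simp: bloch_kernel_def divide_inverse power_inverse)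
  ultimately show ?thesis
    by (simp only: divide_inverse power_inverse[symmetric])
qed

text \<open>The zero \<open>1 / cnj a\<close> of the denominator has modulus
  \<open>1 / cmod a\<close>. This radius exceeds 1, as
  \<open>two_variable_fun_in_little_bloch\<close> asks.\<close>

lemma bloch_kernel_holomorphic:
  assumes "0 < cmod a" "cmod a < 1"
  shows "bloch_kernel s N a holomorphic_on ball 0 (1 / cmod a)"
proof -
  have "1 - cnj a * w \<noteq> 0" if "w \<in> ball 0 (1 / cmod a)" for w
  proof
    assume "1 - cnj a * w = 0"
    then have "cmod (cnj a * w) = 1" by (simp flip: eq_iff_diff_eq_0)
    then show False using that assms by (simp add: norm_mult divide_simps mult.commute)
  qed
  then show ?thesis
    unfolding holomorphic_on_open[OF open_ball] by (blast intro: bloch_kernel_has_derivative)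
qed

lemma bloch_kernel_deriv:
  assumes "cmod a < 1" "cmod w < 1"
  shows "deriv (bloch_kernel s N a) w =
    of_real ((1 - (cmod a)\<^sup>2) powr s) * of_nat N * cnj a / (1 - cnj a * w) ^ Suc N"
  by (rule DERIV_imp_deriv, rule bloch_kernel_has_derivative, rule one_minus_cnj_mult_ge(5)[OF assms])

text \<open>The exponents satisfy \<open>s + p = real N + 1\<close>, the order of the pole of the
  derivative, so numerator and weight together cancel the pole up to a power of 2.\<close>

lemma bloch_kernel_deriv_bound:
  assumes a: "cmod a < 1" and w: "cmod w < 1" and "s = real N + 1 - p" "0 \<le> s" "0 \<le> p"
  shows "cmod (deriv (bloch_kernel s N a) w) * (1 - (cmod w)\<^sup>2) powr p \<le> real N * 2 ^ Suc N"
proof -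
  define x where "x = cmod (1 - cnj a * w)"
  have x: "0 < x" using one_minus_cnj_mult_ge(5)[OF a w] by (simp add: x_def)
  have nn: "0 \<le> 1 - (cmod a)\<^sup>2" "0 \<le> 1 - (cmod w)\<^sup>2"
    using a w by (simp_all add: power_le_one)
  have "(1 - (cmod a)\<^sup>2) powr s * (1 - (cmod w)\<^sup>2) powr p \<le> (2 * x) powr s * (2 * x) powr p"
    using one_minus_cnj_mult_ge[OF a w] nn assms by (intro mult_mono powr_mono2) (auto simp: x_def)
  also have "\<dots> = (2 * x) powr real (Suc N)"
    using assms(3) by (simp flip: powr_add add: add.commute)
  also have "\<dots> = (2 * x) ^ Suc N" using x by (simp only: powr_realpow)
  finally have le: "(1 - (cmod a)\<^sup>2) powr s * (1 - (cmod w)\<^sup>2) powr p \<le> (2 * x) ^ Suc N" .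
  have "cmod (deriv (bloch_kernel s N a) w) * (1 - (cmod w)\<^sup>2) powr p
    = (1 - (cmod a)\<^sup>2) powr s * (1 - (cmod w)\<^sup>2) powr p * (real N * cmod a) / x ^ Suc N"
    unfolding bloch_kernel_deriv[OF a w] x_def by (simp add: norm_mult norm_divide norm_power)
  also have "\<dots> \<le> (2 * x) ^ Suc N * (real N * 1) / x ^ Suc N"
    using a x by (intro divide_right_mono mult_mono le) auto
  also have "\<dots> = real N * 2 ^ Suc N" using x by (simp add: power_mult_distrib field_simps)
  finally show ?thesis .
qed

text \<open>At \<open>w = a\<close> the denominator is a power of the real number
  \<open>1 - (cmod a)\<^sup>2\<close>, so all powers combine to exponent \<open>- p\<close>. This
  reproduces the denominators of the boundary condition.\<close>

lemma bloch_kernel_deriv_diagonal: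
  assumes a: "cmod a < 1" and "s = real N + 1 - p"
  shows "cmod (deriv (bloch_kernel s N a) a) = real N * cmod a / (1 - (cmod a)\<^sup>2) powr p"
proof -
  have pos: "0 < 1 - (cmod a)\<^sup>2" using a by (simp add: power_less_one_iff)
  have "cnj a * a = of_real ((cmod a)\<^sup>2)" by (metis complex_norm_square mult.commute)
  then have "1 - cnj a * a = of_real (1 - (cmod a)\<^sup>2)" by simp
  then have "cmod (1 - cnj a * a) = 1 - (cmod a)\<^sup>2" using pos by (simp only: norm_of_real)
  moreover have "(1 - (cmod a)\<^sup>2) powr s = (1 - (cmod a)\<^sup>2) ^ Suc N / (1 - (cmod a)\<^sup>2) powr p"
    using powr_diff[of "1 - (cmod a)\<^sup>2" "real (Suc N)" p] powr_realpow[OF pos, of "Suc N"] assms(2)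
    by (simp add: add.commute del: power_Suc)
  ultimately show ?thesis
    unfolding bloch_kernel_deriv[OF a a] norm_mult norm_divide norm_power norm_of_real
    using pos by simp
qed

lemma bloch_kernel_bound:
  assumes a: "cmod a < 1" and w: "cmod w < 1"
  shows "cmod (bloch_kernel s N a w) \<le> (1 - (cmod a)\<^sup>2) powr s / (1 - cmod w) ^ N"
  unfolding bloch_kernel_def norm_divide norm_power norm_of_real
  using one_minus_cnj_mult_ge(2,5)[OF a w] w
  by (subst abs_of_nonneg) (auto intro!: divide_left_mono power_mono)

text \<open>For \<open>s = N = 1\<close> the numerator is at most twice the modulus of the
  denominator and equals the denominator at \<open>w = a\<close>.\<close>

lemma bloch_kernel_one:
  assumes a: "cmod a < 1"
  shows "cmod w < 1 \<Longrightarrow> cmod (bloch_kernel 1 1 a w) \<le> 2" "bloch_kernel 1 1 a a = 1"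
proof -
  have pos: "0 < 1 - (cmod a)\<^sup>2" using a by (simp add: power_less_one_iff)
  show "cmod (bloch_kernel 1 1 a w) \<le> 2" if "cmod w < 1"
    using one_minus_cnj_mult_ge[OF a that] pos
    by (simp add: bloch_kernel_def norm_divide divide_simps del: of_real_diff)
  have "cnj a * a = of_real ((cmod a)\<^sup>2)" by (metis complex_norm_square mult.commute)
  then have "1 - cnj a * a = of_real (1 - (cmod a)\<^sup>2)" by simp
  then show "bloch_kernel 1 1 a a = 1"
    using pos one_minus_cnj_mult_ge(5)[OF a a] by (simp add: bloch_kernel_def)
qed

lemma bloch_kernel_null:
  assumes a: "\<And>j. cmod (a j) < 1" "(\<lambda>j. cmod (a j)) \<longlonglongrightarrow> 1" and "cmod w < 1" "0 < s"
  shows "(\<lambda>j. bloch_kernel s N (a j) w) \<longlonglongrightarrow> 0"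
proof (rule Lim_null_comparison)
  show "\<forall>\<^sub>F j in sequentially. cmod (bloch_kernel s N (a j) w) \<le> (1 - (cmod (a j))\<^sup>2) powr s / (1 - cmod w) ^ N"
    using bloch_kernel_bound[OF a(1) assms(3)] by simp
  \<comment> \<open>The base of the power tends to 0, where the limit rule asks for a nonnegative
    base and \<open>0 < s\<close>.\<close>
  have "(cmod (a j))\<^sup>2 \<le> 1" for j using less_imp_le[OF a(1)[of j]] by (simp add: power_le_one)
  then have "(\<lambda>j. (1 - (cmod (a j))\<^sup>2) powr s / (1 - cmod w) ^ N) \<longlonglongrightarrow> (1 - 1\<^sup>2) powr s / (1 - cmod w) ^ N"
    using assms by (intro tendsto_intros tendsto_powr' a(2)) auto
  then show "(\<lambda>j. (1 - (cmod (a j))\<^sup>2) powr s / (1 - cmod w) ^ N) \<longlonglongrightarrow> 0" by simp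
qed

subsection \<open>Necessity of the boundary condition\<close>

lemma little_bloch_metric: "Metric_space (little_bloch p) (norm_dist (little_bloch p) (bloch_norm p))"
  by (rule Metric_space_subset_bloch[OF little_bloch_subset])

text \<open>Compactness gives a subsequence of the images that converges in norm to some
  \<open>g\<close>. Norm limits are pointwise limits and the images tend to 0 pointwise, so
  \<open>g = 0\<close>. A single index with small norm suffices for the contradictions
  below.\<close>

lemma compact_operator_null_sequence:
  fixes \<phi> :: "complex ^ 'n \<Rightarrow> complex ^ 'n"
  assumes T: "compact_operator (little_bloch p) (bloch_norm p) (little_bloch q) (bloch_norm q) (comp_op \<phi>)"
    and \<phi>: "holomorphic_self_map \<phi>" and q: "0 < q"
    and f: "\<And>j :: nat. f j \<in> little_bloch p" "\<And>j. bloch_norm p (f j) \<le> M"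
    and null: "\<And>z. z \<in> polydisk \<Longrightarrow> (\<lambda>j. f j z) \<longlonglongrightarrow> 0" and e: "0 < e"
  shows "\<exists>j. bloch_norm q (comp_op \<phi> (f j)) < e"
proof -
  interpret Metric_space "little_bloch q" "norm_dist (little_bloch q) (bloch_norm q)"
    by (rule little_bloch_metric)
  let ?T = "comp_op \<phi>"
  let ?S = "mtopology closure_of (?T ` range f)"
  have Tf: "?T (f j) \<in> little_bloch q" for j
    using T f(1) by (auto simp: compact_operator_def linear_operator_def)
  have "compactin mtopology ?S"
    using T f unfolding compact_operator_def norm_topology_def
    by (metis (no_types, lifting) image_subset_iff rangeE)
  moreover have "range (\<lambda>j. ?T (f j)) \<subseteq> ?S"
    using Tf by (intro order_trans[OF _ closure_of_subset]) auto
  ultimately obtain g r where g: "strict_mono (r :: nat \<Rightarrow> nat)"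
    "limitin mtopology ((\<lambda>j. ?T (f j)) \<circ> r) g sequentially"
    unfolding compactin_sequentially by meson
  then have g_in: "g \<in> little_bloch q" using limitin_mspace by blast
  have ev: "\<forall>\<^sub>F j in sequentially. bloch_norm q (\<lambda>z. ?T (f (r j)) z - g z) < \<epsilon>" if "0 < \<epsilon>" for \<epsilon>
    using g(2) that g_in Tf unfolding limitin_metric norm_dist_def by (auto elim!: eventually_mono allE[of _ \<epsilon>])
  have sub: "little_bloch q \<subseteq> bloch q" by (rule little_bloch_subset)
  have in_q: "(\<lambda>z. ?T (f (r j)) z - g z) \<in> bloch q" for j
    using Tf g_in sub by (intro bloch_diff) auto
  have norm_lim: "(\<lambda>j. bloch_norm q (\<lambda>z. ?T (f (r j)) z - g z)) \<longlonglongrightarrow> 0"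
    using ev bloch_norm_nonneg[OF in_q] by (intro tendstoI) (auto simp: dist_norm elim!: eventually_mono)
  have "g z = 0" if z: "z \<in> polydisk" for z
  proof -
    obtain C where C: "0 \<le> C" "\<And>h. h \<in> bloch q \<Longrightarrow> cmod (h z) \<le> C * bloch_norm q h"
      using bloch_point_evaluation[OF q z] by blast
    have lim0: "(\<lambda>j. ?T (f (r j)) z - g z) \<longlonglongrightarrow> 0"
      by (rule Lim_null_comparison[OF always_eventually tendsto_mult_right_zero[OF norm_lim, of C]])
        (intro allI C(2)[OF in_q])
    have "(\<lambda>j. ?T (f (r j)) z - g z) \<longlonglongrightarrow> 0 - g z"
      using LIMSEQ_subseq_LIMSEQ[OF null[OF self_map_in_polydisk[OF \<phi> z]] g(1)] z
      by (intro tendsto_diff tendsto_const) (simp add: comp_op_def zero_ext_def o_def)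
    from LIMSEQ_unique[OF this lim0] show ?thesis by simp
  qed
  then have "g = (\<lambda>z. 0)"
    using g_in sub by (auto simp: bloch_def)
  then show ?thesis
    using ev[OF e] by (auto simp: eventually_sequentially)
qed

text \<open>This is the q-Bloch weight of the coordinate function
  \<open>\<lambda>w. \<phi> w $ l\<close>; exchanging the two summations expresses the boundary sum
  through it.\<close>

definition component_weight ::
    "real \<Rightarrow> (complex ^ 'n \<Rightarrow> complex ^ 'n) \<Rightarrow> 'n \<Rightarrow> complex ^ 'n \<Rightarrow> real" where
  "component_weight q \<phi> l z =
     (\<Sum>k\<in>UNIV. cmod (cpartial k (\<lambda>w. \<phi> w $ l) z) * (1 - (cmod (z $ k))\<^sup>2) powr q)"

lemma component_weight_nonneg: "0 \<le> component_weight q \<phi> l z"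
  by (auto simp: component_weight_def intro!: sum_nonneg)

lemma boundary_sum_eq:
  "(\<Sum>k\<in>UNIV. \<Sum>l\<in>UNIV. cmod (cpartial k (\<lambda>w. \<phi> w $ l) z) *
       ((1 - (cmod (z $ k))\<^sup>2) powr q / (1 - (cmod (\<phi> z $ l))\<^sup>2) powr p))
   = (\<Sum>l\<in>UNIV. component_weight q \<phi> l z / (1 - (cmod (\<phi> z $ l))\<^sup>2) powr p)"
  unfolding component_weight_def sum_divide_distrib by (subst sum.swap) simp

text \<open>Assumption \<open>D\<close> says that the gradient of the test function at
  \<open>\<phi> z\<close> has only an l-th entry, namely \<open>E\<close>, so the chain rule leaves
  the l-th coordinate of \<open>\<phi>\<close> alone.\<close>

lemma bloch_weight_comp_two_variable_fun:
  fixes \<phi> :: "complex ^ 'n \<Rightarrow> complex ^ 'n"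
  assumes "holomorphic_self_map \<phi>" "z \<in> polydisk" "F holomorphic_on ball 0 R" "1 \<le> R"
    and D: "\<And>k. (if k = m then deriv F (\<phi> z $ m) * (c + d * \<phi> z $ l) else 0) +
        (if k = l then F (\<phi> z $ m) * d else 0) = (if k = l then E else 0)"
  shows "bloch_weight q (comp_op \<phi> (zero_ext (two_variable_fun F m c d l))) z = cmod E * component_weight q \<phi> l z"
proof -
  let ?f = "two_variable_fun F m c d l"
  have \<phi>z: "\<phi> z \<in> polydisk" using self_map_in_polydisk assms by blast
  have hol: "holomorphic_n polydisk ?f" by (rule holomorphic_n_two_variable_fun[OF assms(3,4)])
  have "(F has_field_derivative deriv F (\<phi> z $ m)) (at (\<phi> z $ m))"
    using polydisk_component_bounds(1)[OF \<phi>z, of m] assms by (intro holomorphic_derivI[OF assms(3)]) auto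
  note f' = cpartial_eqI[OF two_variable_fun_has_derivative[OF this, of c d l]]
  have "cpartial k (zero_ext ?f) (\<phi> z) = (if k = l then E else 0)" for k
    unfolding cpartial_zero_ext[OF hol \<phi>z] f' D ..
  then have "cpartial k (comp_op \<phi> (zero_ext ?f)) z = E * cpartial k (\<lambda>w. \<phi> w $ l) z" for k
    unfolding cpartial_comp_op[OF assms(1) holomorphic_n_zero_ext[OF hol] assms(2)]
    by (simp add: mult_delta_left)
  then show ?thesis
    by (simp add: bloch_weight_def component_weight_def norm_mult sum_distrib_left mult.assoc)
qed

lemma diagonal_sequence_to_boundary:
  assumes "\<And>\<delta> :: real. 0 < \<delta> \<Longrightarrow> \<exists>z\<in>A. 1 - \<delta> < cmod (h z) \<and> P z"
    and "\<And>z. z \<in> A \<Longrightarrow> cmod (h z) < 1"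
  obtains z where "\<And>j :: nat. z j \<in> A" "\<And>j. P (z j)" "\<And>j. 1/2 < cmod (h (z j))"
    "(\<lambda>j. cmod (h (z j))) \<longlonglongrightarrow> 1"
proof -
  \<comment> \<open>Tolerances that start at 1/2 keep every modulus above 1/2.\<close>
  have "\<exists>z. \<forall>j :: nat. z j \<in> A \<and> 1 - inverse (real (Suc (Suc j))) < cmod (h (z j)) \<and> P (z j)"
    by (rule choice) (use assms(1)[of "inverse (real (Suc (Suc _)))"] in \<open>auto simp: Bex_def simp del: of_nat_Suc\<close>)
  then obtain z where z: "\<And>j :: nat. z j \<in> A" "\<And>j. 1 - inverse (real (Suc (Suc j))) < cmod (h (z j))" "\<And>j. P (z j)"
    by blast
  have "1/2 < cmod (h (z j))" for j
  proof -
    have "inverse (real (Suc (Suc j))) \<le> 1/2" by (simp add: field_simps)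
    then show ?thesis using z(2)[of j] by linarith
  qed
  moreover have "(\<lambda>j. cmod (h (z j))) \<longlonglongrightarrow> 1"
  proof (rule tendsto_sandwich)
    show "(\<lambda>j. 1 - inverse (real (Suc (Suc j)))) \<longlonglongrightarrow> 1"
      using tendsto_diff[OF tendsto_const[of 1] LIMSEQ_Suc[OF LIMSEQ_inverse_real_of_nat]] by simp
    show "\<forall>\<^sub>F j in sequentially. 1 - inverse (real (Suc (Suc j))) \<le> cmod (h (z j))"
      using z(2) by (auto intro!: always_eventually less_imp_le)
    show "\<forall>\<^sub>F j in sequentially. cmod (h (z j)) \<le> 1"
      using assms(2) z(1) by (auto intro!: always_eventually less_imp_le)
  qed simp
  ultimately show ?thesis using that z by blast
qed

text \<open>Otherwise some points \<open>z j\<close> violate the bound while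
  \<open>\<phi> (z j) $ l\<close> tends to the circle. Kernels in coordinate \<open>l\<close> with
  these values as parameters are bounded and pointwise null, yet the weights of their images at
  \<open>z j\<close> are at least \<open>e / 2\<close>.\<close>

lemma compact_imp_component_condition:
  fixes \<phi> :: "complex ^ 'n \<Rightarrow> complex ^ 'n"
  assumes T: "compact_operator (little_bloch p) (bloch_norm p) (little_bloch q) (bloch_norm q) (comp_op \<phi>)"
    and \<phi>: "holomorphic_self_map \<phi>" and p: "0 < p" and q: "0 < q" and e: "0 < e"
  shows "\<exists>\<delta>>0. \<forall>z\<in>polydisk. 1 - \<delta> < cmod (\<phi> z $ l) \<longrightarrow>
    component_weight q \<phi> l z / (1 - (cmod (\<phi> z $ l))\<^sup>2) powr p < e"
proof (rule ccontr)
  assume neg: "\<not> ?thesis"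
  have "\<exists>z\<in>polydisk. 1 - \<delta> < cmod (\<phi> z $ l) \<and>
      e \<le> component_weight q \<phi> l z / (1 - (cmod (\<phi> z $ l))\<^sup>2) powr p" if "0 < \<delta>" for \<delta>
    using neg that by (meson not_le)
  then obtain z where z: "\<And>j :: nat. z j \<in> polydisk"
    "\<And>j. e \<le> component_weight q \<phi> l (z j) / (1 - (cmod (\<phi> (z j) $ l))\<^sup>2) powr p"
    "\<And>j. 1/2 < cmod (\<phi> (z j) $ l)" "(\<lambda>j. cmod (\<phi> (z j) $ l)) \<longlonglongrightarrow> 1"
    by (rule diagonal_sequence_to_boundary)
      (use polydisk_component_bounds(1) self_map_in_polydisk[OF \<phi>] in auto)
  define a where "a j = \<phi> (z j) $ l" for j
  have a: "cmod (a j) < 1" "1/2 < cmod (a j)" "0 < cmod (a j)" for j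
    using z(3)[of j] polydisk_component_bounds(1)[OF self_map_in_polydisk[OF \<phi> z(1)]]
    by (auto simp: a_def elim: less_trans[rotated])
  \<comment> \<open>Rounding \<open>p\<close> up makes \<open>s\<close> positive and
    \<open>N\<close> at least 1, so the factor \<open>real N * cmod (a j)\<close> stays above
    1/2.\<close>
  define N where "N = nat \<lceil>p\<rceil>"
  define s where "s = real N + 1 - p"
  have N: "p \<le> real N" "1 \<le> N" using p unfolding N_def by linarith+
  then have s: "0 < s" by (simp add: s_def)
  define F where "F j = bloch_kernel s N (a j)" for j
  define f where "f j = zero_ext (two_variable_fun (F j) l 1 0 l)" for j
  have R: "1 < 1 / cmod (a j)" for j using a[of j] by (simp add: divide_simps)
  have F: "F j holomorphic_on ball 0 (1 / cmod (a j))" for j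
    unfolding F_def using a by (intro bloch_kernel_holomorphic)
  have f_in: "f j \<in> little_bloch p" for j
    unfolding f_def by (rule two_variable_fun_in_little_bloch[OF F R p])
  have F0: "cmod (F j 0) \<le> 1" for j
  proof -
    have "(1 - (cmod (a j))\<^sup>2) powr s \<le> 1"
      using a(1)[of j] s by (intro powr_le1) (auto simp: power_le_one)
    then show ?thesis
      using bloch_kernel_bound[OF a(1)[of j], of 0 s N] by (simp add: F_def)
  qed
  \<comment> \<open>The summands are the value at 0, the kernel bound, and \<open>B = 0\<close>,
    available because \<open>d = 0\<close>.\<close>
  have bnd: "bloch_norm p (f j) \<le> 1 * 1 + (real N * 2 ^ Suc N * (cmod 1 + cmod 0) + 0)" for j
    unfolding f_def
    by (rule order_trans[OF bloch_two_variable_fun(2)[OF F less_imp_le[OF R] p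
            bloch_kernel_deriv_bound[OF a(1) _ s_def less_imp_le[OF s] less_imp_le[OF p], folded F_def], where B = 0]])
      (use F0[of j] in auto)
  have null: "(\<lambda>j. f j w) \<longlonglongrightarrow> 0" if "w \<in> polydisk" for w
    using bloch_kernel_null[OF a(1) z(4)[folded a_def] polydisk_component_bounds(1)[OF that, of l] s] that
    by (simp add: f_def zero_ext_def two_variable_fun_def F_def)
  obtain j where j: "bloch_norm q (comp_op \<phi> (f j)) < e / 2"
    using compact_operator_null_sequence[OF T \<phi> q f_in bnd null half_gt_zero[OF e]] by blast
  have "comp_op \<phi> (f j) \<in> bloch q"
    using T f_in[of j] little_bloch_subset[of q] unfolding compact_operator_def linear_operator_def by blast
  from bloch_norm_bounds(2)[OF this z(1)[of j]]
  have "bloch_weight q (comp_op \<phi> (f j)) (z j) < e / 2" using j by linarith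
  also have "bloch_weight q (comp_op \<phi> (f j)) (z j) =
      cmod (deriv (F j) (a j)) * component_weight q \<phi> l (z j)"
    unfolding f_def using bloch_weight_comp_two_variable_fun[OF \<phi> z(1) F less_imp_le[OF R]] by (simp add: a_def)
  also have "\<dots> = real N * cmod (a j) * (component_weight q \<phi> l (z j) / (1 - (cmod (a j))\<^sup>2) powr p)"
    unfolding F_def bloch_kernel_deriv_diagonal[OF a(1) s_def] by simp
  finally have lt: "real N * cmod (a j) * (component_weight q \<phi> l (z j) / (1 - (cmod (a j))\<^sup>2) powr p) < e / 2" .
  have "1 * (1/2) * e \<le> real N * cmod (a j) * (component_weight q \<phi> l (z j) / (1 - (cmod (a j))\<^sup>2) powr p)"
    using N a(2)[of j] z(2)[of j] e by (intro mult_mono) (auto simp: a_def)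
  with lt show False by simp
qed

text \<open>For \<open>p \<ge> 1\<close> bounded functions of one coordinate are Bloch functions, which allows test functions
  that tend to \<open>0\<close> pointwise but take the value \<open>1\<close> at \<open>\<phi>\<^sub>m(z\<^sub>j)\<close>; the factor
  \<open>w\<^sub>l - \<phi>\<^sub>l(z\<^sub>j)\<close> then isolates the derivative of \<open>\<phi>\<^sub>l\<close>.\<close>
lemma compact_imp_cross_condition:
  fixes \<phi> :: "complex ^ 'n \<Rightarrow> complex ^ 'n"
  assumes T: "compact_operator (little_bloch p) (bloch_norm p) (little_bloch q) (bloch_norm q) (comp_op \<phi>)"
    and \<phi>: "holomorphic_self_map \<phi>" and p: "1 \<le> p" and q: "0 < q" and e: "0 < e"
  shows "\<exists>\<delta>>0. \<forall>z\<in>polydisk. 1 - \<delta> < cmod (\<phi> z $ m) \<longrightarrow> component_weight q \<phi> l z < e"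
proof (rule ccontr)
  assume neg: "\<not> ?thesis"
  have "\<exists>z\<in>polydisk. 1 - \<delta> < cmod (\<phi> z $ m) \<and> e \<le> component_weight q \<phi> l z" if "0 < \<delta>" for \<delta>
    using neg that by (meson not_le)
  then obtain z where z: "\<And>j :: nat. z j \<in> polydisk" "\<And>j. e \<le> component_weight q \<phi> l (z j)"
    "\<And>j. 1/2 < cmod (\<phi> (z j) $ m)" "(\<lambda>j. cmod (\<phi> (z j) $ m)) \<longlonglongrightarrow> 1"
    by (rule diagonal_sequence_to_boundary)
      (use polydisk_component_bounds(1) self_map_in_polydisk[OF \<phi>] in auto)
  have \<phi>z: "\<phi> (z j) \<in> polydisk" for j using self_map_in_polydisk[OF \<phi> z(1)] .
  define a where "a j = \<phi> (z j) $ m" for j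
  define b where "b j = \<phi> (z j) $ l" for j
  have a: "cmod (a j) < 1" "0 < cmod (a j)" for j
    using z(3)[of j] polydisk_component_bounds(1)[OF \<phi>z]
    by (auto simp: a_def elim: less_trans[rotated])
  have b: "cmod (b j) \<le> 1" for j
    using polydisk_component_bounds(1)[OF \<phi>z] by (auto simp: b_def less_imp_le)
  have p0: "0 < p" using p by simp
  define F where "F j = bloch_kernel 1 1 (a j)" for j
  define f where "f j = zero_ext (two_variable_fun (F j) m (- b j) 1 l)" for j
  have R: "1 < 1 / cmod (a j)" for j using a[of j] by (simp add: divide_simps)
  have F: "F j holomorphic_on ball 0 (1 / cmod (a j))" for j
    unfolding F_def using a by (intro bloch_kernel_holomorphic)
  have f_in: "f j \<in> little_bloch p" for j
    unfolding f_def by (rule two_variable_fun_in_little_bloch[OF F R p0])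
  have Fle: "cmod (F j w) \<le> 2" if "cmod w < 1" for j w
    unfolding F_def by (rule bloch_kernel_one(1)[OF a(1) that])
  \<comment> \<open>For \<open>p \<ge> 1\<close> the weight with exponent \<open>p\<close> is at
    most the one with exponent 1, and \<open>s = N = 1\<close> is the matching pair for exponent
    1.\<close>
  have F': "cmod (deriv (F j) w) * (1 - (cmod w)\<^sup>2) powr p \<le> 4" if w: "cmod w < 1" for j w
  proof -
    have "(1 - (cmod w)\<^sup>2) powr p \<le> (1 - (cmod w)\<^sup>2) powr 1"
      using w p by (intro powr_mono') (auto simp: power_le_one)
    then have "cmod (deriv (F j) w) * (1 - (cmod w)\<^sup>2) powr p
        \<le> cmod (deriv (F j) w) * (1 - (cmod w)\<^sup>2) powr 1"
      by (rule mult_left_mono) simp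
    also have "\<dots> \<le> real 1 * 2 ^ Suc 1"
      unfolding F_def by (rule bloch_kernel_deriv_bound[OF a(1) w]) auto
    finally show ?thesis by simp
  qed
  \<comment> \<open>12 is 2 + 4 * 2 + 2, from \<open>cmod (b j) \<le> 1\<close> and the bounds 2 and
    4 on \<open>F j\<close> and its weighted derivative.\<close>
  have bnd: "bloch_norm p (f j) \<le> 12" for j
  proof -
    have "bloch_norm p (f j) \<le> cmod (F j 0) * cmod (- b j) + (4 * (cmod (- b j) + cmod 1) + 2)"
      unfolding f_def
      by (rule bloch_two_variable_fun(2)[OF F less_imp_le[OF R] p0 F']) (use Fle in auto)
    moreover have "cmod (F j 0) * cmod (- b j) \<le> 2 * 1"
      using Fle[of 0 j] b[of j] by (intro mult_mono) auto
    ultimately show ?thesis using b[of j] by simp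
  qed
  have null: "(\<lambda>j. f j w) \<longlonglongrightarrow> 0" if w: "w \<in> polydisk" for w
  proof (rule Lim_null_comparison)
    have "(\<lambda>j. F j (w $ m)) \<longlonglongrightarrow> 0"
      unfolding F_def
      by (rule bloch_kernel_null[OF a(1) z(4)[folded a_def] polydisk_component_bounds(1)[OF w]]) simp
    from tendsto_mult_left_zero[OF tendsto_norm_zero[OF this], of 2]
    show "(\<lambda>j. cmod (F j (w $ m)) * 2) \<longlonglongrightarrow> 0" .
    have "cmod (- b j + w $ l) \<le> 2" for j
      using norm_triangle_ineq[of "- b j" "w $ l"] b[of j] polydisk_component_bounds(1)[OF w, of l] by simp
    then show "\<forall>\<^sub>F j in sequentially. cmod (f j w) \<le> cmod (F j (w $ m)) * 2"
      using w by (auto simp: f_def zero_ext_def two_variable_fun_def norm_mult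
          intro!: always_eventually mult_left_mono)
  qed
  obtain j where j: "bloch_norm q (comp_op \<phi> (f j)) < e"
    using compact_operator_null_sequence[OF T \<phi> q f_in bnd null e] by blast
  have "comp_op \<phi> (f j) \<in> bloch q"
    using T f_in[of j] little_bloch_subset[of q] unfolding compact_operator_def linear_operator_def by blast
  from bloch_norm_bounds(2)[OF this z(1)[of j]]
  have "bloch_weight q (comp_op \<phi> (f j)) (z j) < e" using j by linarith
  \<comment> \<open>At \<open>\<phi> (z j)\<close> the affine factor is 0 and the kernel is 1, so
    the gradient is the unit vector in direction \<open>l\<close>, also when
    \<open>m = l\<close>.\<close>
  moreover have "bloch_weight q (comp_op \<phi> (f j)) (z j) = cmod 1 * component_weight q \<phi> l (z j)"
    unfolding f_def
    by (rule bloch_weight_comp_two_variable_fun[OF \<phi> z(1) F less_imp_le[OF R]])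
      (use bloch_kernel_one(2)[OF a(1)] in \<open>auto simp: a_def b_def F_def\<close>)
  ultimately show False using z(2)[of j] by simp
qed

section \<open>From conditions on single coordinates to the boundary condition\<close>

text \<open>A frontier point of the open polydisk has a coordinate of modulus at least 1, and
  coordinates are 1-Lipschitz.\<close>

lemma near_frontier_polydisk:
  fixes w :: "complex ^ 'n"
  assumes "infdist w (frontier polydisk) < \<delta>"
  shows "\<exists>k. 1 - \<delta> < cmod (w $ k)"
proof -
  \<comment> \<open>\<open>infdist\<close> to the empty set is 0 by convention, so a nearby frontier
    point exists only once the frontier is known to be nonempty.\<close>
  have "frontier polydisk \<noteq> ({} :: (complex ^ 'n) set)"
  proof
    assume "frontier polydisk = ({} :: (complex ^ 'n) set)"
    then have "polydisk = (UNIV :: (complex ^ 'n) set)"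
      using zero_in_polydisk frontier_eq_empty by blast
    then have "(\<chi> k. 1) \<in> (polydisk :: (complex ^ 'n) set)" by blast
    then show False by (simp add: polydisk_def)
  qed
  from assms[unfolded infdist_notempty[OF this]]
  obtain v where v: "v \<in> frontier polydisk" "dist w v < \<delta>"
    by (subst (asm) cINF_less_iff) (use \<open>frontier polydisk \<noteq> {}\<close> in \<open>auto intro: bdd_belowI2[of _ 0]\<close>)
  then have "v \<notin> polydisk"
    using frontier_disjoint_eq open_polydisk by blast
  then obtain k where "1 \<le> cmod (v $ k)" by (auto simp: polydisk_def not_less)
  moreover have "cmod (v $ k) \<le> cmod (w $ k) + norm (v - w)"
    using Finite_Cartesian_Product.norm_nth_le[of "v - w" k] norm_triangle_ineq2[of "v $ k" "w $ k"] by simp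
  ultimately show ?thesis
    using v(2) by (intro exI[of _ k]) (simp add: dist_norm norm_minus_commute)
qed

text \<open>Near the frontier some coordinate \<open>m\<close> of \<open>\<phi> z\<close> is close
  to the circle. For each \<open>l\<close>, either coordinate \<open>l\<close> is close too and the
  component condition applies, or the denominator is bounded below and the cross condition makes the
  numerator small.\<close>

lemma compact_imp_boundary_condition:
  fixes \<phi> :: "complex ^ 'n \<Rightarrow> complex ^ 'n"
  assumes T: "compact_operator (little_bloch p) (bloch_norm p) (little_bloch q) (bloch_norm q) (comp_op \<phi>)"
    and \<phi>: "holomorphic_self_map \<phi>" and p: "1 \<le> p" and q: "0 < q"
  shows "boundary_condition p q \<phi>"
  unfolding boundary_condition_def tends_to_zero_at_boundary_def boundary_sum_eq
proof (intro allI impI)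
  fix e :: real assume e: "0 < e"
  define e' where "e' = e / real CARD('n)"
  have e': "0 < e'" using e by (simp add: e'_def)
  have p0: "0 < p" using p by simp
  obtain \<alpha> where \<alpha>: "\<And>l. 0 < \<alpha> l" "\<And>l z. z \<in> polydisk \<Longrightarrow> 1 - \<alpha> l < cmod (\<phi> z $ l) \<Longrightarrow>
      component_weight q \<phi> l z / (1 - (cmod (\<phi> z $ l))\<^sup>2) powr p < e'"
    using compact_imp_component_condition[OF T \<phi> p0 q e'] by metis
  \<comment> \<open>The cap 1/2 keeps \<open>1 - \<beta> l\<close> nonnegative, so that its square
    is below 1.\<close>
  define \<beta> where "\<beta> l = min (\<alpha> l) (1/2)" for l
  \<comment> \<open>This is \<open>e'\<close> times a lower bound of the denominator where
    \<open>cmod (\<phi> z $ l) \<le> 1 - \<beta> l\<close>.\<close>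
  define \<eta> where "\<eta> l = e' * (1 - (1 - \<beta> l)\<^sup>2) powr p" for l
  have \<beta>: "0 < \<beta> l" "\<beta> l \<le> 1/2" "\<beta> l \<le> \<alpha> l" for l using \<alpha>(1)[of l] by (auto simp: \<beta>_def)
  have pos: "0 < 1 - (1 - \<beta> l)\<^sup>2" for l using \<beta>[of l] by (simp add: power_less_one_iff)
  have \<eta>: "0 < \<eta> l" for l
    unfolding \<eta>_def using e' pos[of l] by (intro mult_pos_pos) (auto simp: powr_gt_zero)
  have "\<exists>\<delta>>0. \<forall>z\<in>polydisk. 1 - \<delta> < cmod (\<phi> z $ m) \<longrightarrow> component_weight q \<phi> l z < \<eta> l" for m l
    by (rule compact_imp_cross_condition[OF T \<phi> p q \<eta>])
  then obtain \<gamma> where \<gamma>: "\<And>m l. 0 < \<gamma> m l" "\<And>m l z. z \<in> polydisk \<Longrightarrow> 1 - \<gamma> m l < cmod (\<phi> z $ m) \<Longrightarrow>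
      component_weight q \<phi> l z < \<eta> l"
    by metis
  define \<delta> where "\<delta> = Min (range (\<lambda>(m, l). \<gamma> m l))"
  have \<delta>: "0 < \<delta>" "\<delta> \<le> \<gamma> m l" for m l
    using \<gamma>(1) by (auto simp: \<delta>_def intro!: Min_le rev_image_eqI[of "(m, l)"])
  show "\<exists>\<delta>>0. \<forall>z\<in>polydisk. infdist (\<phi> z) (frontier polydisk) < \<delta> \<longrightarrow>
      \<bar>\<Sum>l\<in>UNIV. component_weight q \<phi> l z / (1 - (cmod (\<phi> z $ l))\<^sup>2) powr p\<bar> < e"
  proof (intro exI[of _ \<delta>] conjI ballI impI \<delta>(1))
    fix z :: "complex ^ 'n" assume z: "z \<in> polydisk" "infdist (\<phi> z) (frontier polydisk) < \<delta>"
    obtain m where m: "1 - \<delta> < cmod (\<phi> z $ m)" using near_frontier_polydisk[OF z(2)] by blast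
    have "component_weight q \<phi> l z / (1 - (cmod (\<phi> z $ l))\<^sup>2) powr p < e'" for l
    proof (cases "1 - \<beta> l < cmod (\<phi> z $ l)")
      case True
      then show ?thesis using \<alpha>(2)[OF z(1), of l] \<beta>(3)[of l] by linarith
    next
      case False
      have "component_weight q \<phi> l z < \<eta> l" using \<gamma>(2)[OF z(1), of m l] \<delta>(2)[of m l] m by linarith
      moreover have "(1 - (1 - \<beta> l)\<^sup>2) powr p \<le> (1 - (cmod (\<phi> z $ l))\<^sup>2) powr p"
        using False pos[of l] p0 by (intro powr_mono2 diff_left_mono power_mono) auto
      ultimately have "component_weight q \<phi> l z < e' * (1 - (cmod (\<phi> z $ l))\<^sup>2) powr p"
        unfolding \<eta>_def using e' by (meson less_le_trans mult_left_mono less_imp_le)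
      then show ?thesis
        using polydisk_component_bounds(2)[OF self_map_in_polydisk[OF \<phi> z(1)], of l] by (simp add: pos_divide_less_eq)
    qed
    then have "(\<Sum>l\<in>UNIV. component_weight q \<phi> l z / (1 - (cmod (\<phi> z $ l))\<^sup>2) powr p) < (\<Sum>l\<in>(UNIV :: 'n set). e')"
      by (intro sum_strict_mono) auto
    moreover have "0 \<le> (\<Sum>l\<in>UNIV. component_weight q \<phi> l z / (1 - (cmod (\<phi> z $ l))\<^sup>2) powr p)"
      by (intro sum_nonneg) (simp add: component_weight_nonneg)
    ultimately show "\<bar>\<Sum>l\<in>UNIV. component_weight q \<phi> l z / (1 - (cmod (\<phi> z $ l))\<^sup>2) powr p\<bar> < e"
      by (simp add: e'_def)
  qed
qed

text \<open>The function is the image of a monomial, which lies in the little p-Bloch space.\<close>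

lemma linear_operator_monomials:
  fixes \<phi> :: "complex ^ 'n \<Rightarrow> complex ^ 'n"
  assumes T: "linear_operator (little_bloch p) (little_bloch q) (comp_op \<phi>)"
    and \<phi>: "holomorphic_self_map \<phi>" and p: "0 < p"
  shows "zero_ext (\<lambda>z. \<Prod>l\<in>UNIV. (\<phi> z $ l) ^ \<gamma> l) \<in> little_bloch q"
proof -
  have "comp_op \<phi> (zero_ext (\<lambda>z. \<Prod>k\<in>UNIV. (z $ k) ^ \<gamma> k)) \<in> little_bloch q"
    using T monomial_in_little_bloch[OF p, of \<gamma>] by (auto simp: linear_operator_def)
  moreover have "comp_op \<phi> (zero_ext (\<lambda>z. \<Prod>k\<in>UNIV. (z $ k) ^ \<gamma> k)) = zero_ext (\<lambda>z. \<Prod>l\<in>UNIV. (\<phi> z $ l) ^ \<gamma> l)"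
    using self_map_in_polydisk[OF \<phi>] by (auto simp: comp_op_def zero_ext_def)
  ultimately show ?thesis by simp
qed

subsection \<open>Montel's theorem for Bloch functions\<close>

lemma slice_has_field_derivative:
  fixes h :: "complex ^ 'n \<Rightarrow> complex" and z :: "complex ^ 'n" and k :: 'n
  defines "u \<equiv> \<lambda>w. \<chi> j. if j = k then w else z $ j"
  assumes "holomorphic_n S h" "u w \<in> S"
  shows "((\<lambda>w. h (u w)) has_field_derivative cpartial k h (u w)) (at w)"
proof -
  have u: "u w = (\<chi> j. if j = k then 0 else z $ j) + axis k w" for w
    by (simp add: u_def axis_def vec_eq_iff)
  have "bounded_linear (axis k :: complex \<Rightarrow> complex ^ 'n)"
    by (intro linear_conv_bounded_linear[THEN iffD1] linearI) (auto simp: axis_def vec_eq_iff)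
  then have "(u has_derivative axis k) (at w)"
    unfolding u[abs_def] by (auto intro!: derivative_eq_intros bounded_linear_imp_has_derivative)
  from has_derivative_compose[OF this holomorphic_n_has_derivative[OF assms(2,3)]]
  have "((\<lambda>w. h (u w)) has_derivative (\<lambda>x. \<Sum>i\<in>UNIV. cpartial i h (u w) * axis k x $ i)) (at w)" .
  moreover have "(\<lambda>x. \<Sum>i\<in>UNIV. cpartial i h (u w) * axis k x $ i) = (*) (cpartial k h (u w))"
    by (simp add: fun_eq_iff axis_def mult_delta_right)
  ultimately show ?thesis by (simp add: has_field_derivative_def)
qed

text \<open>Cauchy's inequality for the slice in coordinate \<open>k\<close>: with the other
  coordinates fixed, the disk of radius \<open>\<rho>' - \<rho>\<close> about \<open>z $ k\<close>
  stays in the larger polydisk.\<close>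

lemma cpartial_Cauchy_inequality:
  fixes h :: "complex ^ 'n \<Rightarrow> complex"
  assumes h: "holomorphic_n polydisk h" and \<rho>: "\<rho> < \<rho>'" "\<rho>' < 1"
    and B: "\<And>w. w \<in> closed_polydisk \<rho>' \<Longrightarrow> cmod (h w) \<le> B" and z: "z \<in> closed_polydisk \<rho>"
  shows "cmod (cpartial k h z) \<le> B / (\<rho>' - \<rho>)"
proof -
  let ?u = "\<lambda>w. \<chi> j. if j = k then w else z $ j"
  have u: "?u w \<in> closed_polydisk \<rho>'" if "w \<in> cball (z $ k) (\<rho>' - \<rho>)" for w
  proof -
    have "cmod w \<le> cmod (z $ k) + dist (z $ k) w"
      using norm_triangle_ineq2[of w "z $ k"] by (simp add: dist_norm norm_minus_commute)
    moreover have "cmod (z $ j) \<le> \<rho>" for j using z by (simp add: closed_polydisk_def)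
    ultimately show ?thesis using that \<rho>
      by (auto simp: closed_polydisk_def intro: order_trans[OF _ less_imp_le[OF \<rho>(1)]])
        (smt (verit, best))
  qed
  then have D: "((\<lambda>w. h (?u w)) has_field_derivative cpartial k h (?u w)) (at w)"
    if "w \<in> cball (z $ k) (\<rho>' - \<rho>)" for w
    using that closed_polydisk_subset[OF \<rho>(2)] by (intro slice_has_field_derivative[OF h]) auto
  have "cmod ((deriv ^^ 1) (\<lambda>w. h (?u w)) (z $ k)) \<le> fact 1 * B / (\<rho>' - \<rho>) ^ 1"
  proof (rule Cauchy_inequality)
    show "(\<lambda>w. h (?u w)) holomorphic_on ball (z $ k) (\<rho>' - \<rho>)"
      unfolding holomorphic_on_open[OF open_ball] using D by (meson ball_subset_cball subsetD)
    show "continuous_on (cball (z $ k) (\<rho>' - \<rho>)) (\<lambda>w. h (?u w))"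
      using D DERIV_isCont continuous_at_imp_continuous_on by blast
    show "cmod (h (?u x)) \<le> B" if "cmod (z $ k - x) = \<rho>' - \<rho>" for x
      using that by (intro B u) (simp add: dist_norm)
  qed (use \<rho> in simp)
  then show ?thesis by (simp add: cpartial_def)
qed

text \<open>An e/3 argument: the common Lipschitz bound transfers convergence at points of the dense
  set \<open>T\<close> to their neighbours, and by compactness finitely many points suffice.\<close>

lemma bloch_uniformly_Cauchy_on_closed_polydisk:
  fixes f :: "nat \<Rightarrow> complex ^ 'n \<Rightarrow> complex"
  assumes p: "0 < p" and f: "\<And>j. f j \<in> bloch p" "\<And>j. bloch_norm p (f j) \<le> M"
    and T: "polydisk \<subseteq> closure T" "T \<subseteq> polydisk" "\<And>t. t \<in> T \<Longrightarrow> convergent (\<lambda>j. f j t)"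
    and \<rho>: "0 \<le> \<rho>" "\<rho> < 1"
  shows "uniformly_Cauchy_on (closed_polydisk \<rho>) f"
  unfolding uniformly_Cauchy_on_def
proof (intro allI impI)
  fix e :: real assume e: "0 < e"
  \<comment> \<open>Points of \<open>T\<close> near the polydisk of radius \<open>\<rho>\<close> may
    lie outside it, so the Lipschitz bound is taken on a larger one.\<close>
  define \<rho>' where "\<rho>' = (1 + \<rho>) / 2"
  have \<rho>': "0 \<le> \<rho>'" "\<rho>' < 1" "\<rho> + (1 - \<rho>) / 2 = \<rho>'" using \<rho> by (auto simp: \<rho>'_def field_simps)
  define L where "L = real CARD('n) * (M / (1 - \<rho>'\<^sup>2) powr p)"
  have "0 \<le> M" using bloch_norm_nonneg[OF f(1)[of 0]] f(2)[of 0] by linarith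
  then have L: "0 \<le> L" by (simp add: L_def)
  have Lip: "cmod (f j x - f j y) \<le> L * norm (x - y)"
    if "x \<in> closed_polydisk \<rho>'" "y \<in> closed_polydisk \<rho>'" for j x y
    unfolding L_def by (rule bloch_Lipschitz_on_closed_polydisk[OF f p \<rho>'(1,2) that])
  \<comment> \<open>The first entry makes Lipschitz errors at most \<open>e / 3\<close>, its summand
    1 covering \<open>L = 0\<close>; the second keeps \<open>d\<close>-neighbours within radius
    \<open>\<rho>'\<close>.\<close>
  define d where "d = min (e / (3 * (L + 1))) ((1 - \<rho>) / 2)"
  have d: "0 < d" "L * d \<le> e / 3" "d \<le> (1 - \<rho>) / 2"
  proof -
    show "0 < d" using e \<rho> L by (simp add: d_def)
    show "d \<le> (1 - \<rho>) / 2" unfolding d_def by (rule min.cobounded2)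
    have "L * d \<le> (L + 1) * (e / (3 * (L + 1)))"
      using L e \<rho> by (intro mult_mono) (auto simp: d_def)
    also have "(L + 1) * (e / (3 * (L + 1))) = e / 3"
      using L nonzero_mult_div_cancel_left[of "L + 1" "e / 3"] by (simp add: field_simps)
    finally show "L * d \<le> e / 3" .
  qed
  let ?T = "T \<inter> closed_polydisk \<rho>'"
  have near: "t \<in> closed_polydisk \<rho>'" if "z \<in> closed_polydisk \<rho>" "dist t z < d" for t z :: "complex ^ 'n"
    unfolding closed_polydisk_def
  proof (intro CollectI allI)
    fix k
    have "cmod (t $ k) \<le> cmod (z $ k) + norm (t - z)"
      using Finite_Cartesian_Product.norm_nth_le[of "t - z" k] norm_triangle_ineq2[of "t $ k" "z $ k"] by simp
    moreover have "cmod (z $ k) \<le> \<rho>" using that by (simp add: closed_polydisk_def)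
    ultimately show "cmod (t $ k) \<le> \<rho>'" 
      using that(2) d(3) \<rho>'(3) unfolding dist_norm by linarith
  qed
  have "closed_polydisk \<rho> \<subseteq> (\<Union>t\<in>?T. ball t d)"
  proof
    fix z :: "complex ^ 'n" assume z: "z \<in> closed_polydisk \<rho>"
    then have "z \<in> closure T" using T(1) closed_polydisk_subset[OF \<rho>(2)] by blast
    then obtain t where "t \<in> T" "dist t z < d" using d(1) by (auto simp: closure_approachable)
    then show "z \<in> (\<Union>t\<in>?T. ball t d)" using near[OF z] by auto
  qed
  from compactE_image[OF compact_closed_polydisk _ this]
  obtain F where F: "F \<subseteq> ?T" "finite F" "closed_polydisk \<rho> \<subseteq> (\<Union>t\<in>F. ball t d)" by auto
  have "\<exists>N. \<forall>m\<ge>N. \<forall>n\<ge>N. dist (f m t) (f n t) < e / 3" if "t \<in> F" for t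
  proof (rule metric_CauchyD)
    show "Cauchy (\<lambda>j. f j t)" using T(3)[of t] that F(1) by (auto simp: Cauchy_convergent_iff)
  qed (use e in simp)
  then obtain N where N: "\<And>t m n. t \<in> F \<Longrightarrow> N t \<le> m \<Longrightarrow> N t \<le> n \<Longrightarrow> dist (f m t) (f n t) < e / 3"
    by metis
  have "dist (f m z) (f n z) < e"
    if z: "z \<in> closed_polydisk \<rho>" and mn: "Max (insert 0 (N ` F)) \<le> m" "Max (insert 0 (N ` F)) \<le> n" for z m n
  proof -
    obtain t where t: "t \<in> F" "dist t z < d" using F(3) z by auto
    have "N t \<le> m" "N t \<le> n" using mn t(1) F(2) by auto
    then have "dist (f m t) (f n t) < e / 3" using N t(1) by blast
    moreover have "cmod (f j t - f j z) \<le> e / 3" for j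
    proof -
      have "cmod (f j t - f j z) \<le> L * norm (t - z)"
        using near[OF z t(2)] near[OF z, of z] d(1) by (intro Lip) simp_all
      also have "\<dots> \<le> L * d" using t(2) L by (intro mult_left_mono) (auto simp: dist_norm)
      finally show ?thesis using d(2) by linarith
    qed
    from this[of m] this[of n] have "dist (f m t) (f m z) \<le> e / 3" "dist (f n t) (f n z) \<le> e / 3"
      by (simp_all add: dist_norm)
    moreover have "dist (f m z) (f n z) \<le> dist (f m t) (f m z) + dist (f m t) (f n t) + dist (f n t) (f n z)"
      by (smt (verit) dist_commute dist_triangle)
    ultimately show ?thesis by linarith
  qed
  then show "\<exists>N. \<forall>x\<in>closed_polydisk \<rho>. \<forall>m\<ge>N. \<forall>n\<ge>N. dist (f m x) (f n x) < e" by blast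
qed

lemma holomorphic_n_diff:
  assumes "holomorphic_n S f" "holomorphic_n S g"
  shows "holomorphic_n S (\<lambda>z. f z - g z)"
  unfolding holomorphic_n_def by (intro ballI exI) (rule diff_derivative[OF assms])

text \<open>Cauchy's inequality for the differences \<open>f m - f n\<close> transfers the property
  to the partial derivatives at the price of a smaller radius.\<close>

lemma cpartial_uniformly_Cauchy:
  fixes f :: "nat \<Rightarrow> complex ^ 'n \<Rightarrow> complex"
  assumes hol: "\<And>j. holomorphic_n polydisk (f j)"
    and \<rho>: "\<rho> < \<rho>'" "\<rho>' < 1" and C: "uniformly_Cauchy_on (closed_polydisk \<rho>') f"
  shows "uniformly_Cauchy_on (closed_polydisk \<rho>) (\<lambda>j. cpartial k (f j))"
  unfolding uniformly_Cauchy_on_def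
proof (intro allI impI)
  fix e :: real assume e: "0 < e"
  then have "0 < e * (\<rho>' - \<rho>) / 2" using \<rho> by simp
  then obtain N where N: "\<And>x m n. x \<in> closed_polydisk \<rho>' \<Longrightarrow> N \<le> m \<Longrightarrow> N \<le> n \<Longrightarrow>
      dist (f m x) (f n x) < e * (\<rho>' - \<rho>) / 2"
    using C unfolding uniformly_Cauchy_on_def by metis
  have "dist (cpartial k (f m) z) (cpartial k (f n) z) < e"
    if "z \<in> closed_polydisk \<rho>" "N \<le> m" "N \<le> n" for z m n
  proof -
    have zU: "z \<in> polydisk" using that(1) closed_polydisk_subset[of \<rho>] \<rho> by auto
    have "cmod (cpartial k (\<lambda>z. f m z - f n z) z) \<le> (e * (\<rho>' - \<rho>) / 2) / (\<rho>' - \<rho>)"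
      using N that(2,3) by (intro cpartial_Cauchy_inequality[OF holomorphic_n_diff[OF hol hol] \<rho> _ that(1)])
        (auto simp: dist_norm intro: less_imp_le)
    also have "\<dots> = e / 2" 
    proof -
      have "e * t / 2 / t = e / 2" if "t \<noteq> 0" for t :: real using that by simp
      then show ?thesis by this (use \<rho>(1) in simp)
    qed
    also have "\<dots> < e" using e by simp
    finally show ?thesis by (simp add: cpartial_diff[OF hol hol zU] dist_norm)
  qed
  then show "\<exists>N. \<forall>x\<in>closed_polydisk \<rho>. \<forall>m\<ge>N. \<forall>n\<ge>N. dist (cpartial k (f m) x) (cpartial k (f n) x) < e"
    by blast
qed

lemma in_interior_closed_polydisk:
  fixes z :: "complex ^ 'n"
  assumes "z \<in> closed_polydisk \<rho>" "\<rho> < \<rho>'"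
  shows "z \<in> interior (closed_polydisk \<rho>')"
proof (rule interiorI)
  have "{w :: complex ^ 'n. \<forall>k. cmod (w $ k) < \<rho>'} = (\<Inter>k. {w. cmod (w $ k) < \<rho>'})" by auto
  then show "open {w :: complex ^ 'n. \<forall>k. cmod (w $ k) < \<rho>'}"
    by (auto intro!: open_INT open_Collect_less continuous_intros)
qed (use assms in \<open>auto simp: closed_polydisk_def less_imp_le intro: le_less_trans\<close>)

text \<open>A diagonal subsequence converges on a countable dense set, hence is uniformly Cauchy on
  closed polydisks together with its partial derivatives. Termwise differentiation identifies the
  limits of the partials as those of \<open>g\<close>, and the weight bound passes to the limit
  pointwise.\<close>

lemma bloch_Montel:
  fixes f :: "nat \<Rightarrow> complex ^ 'n \<Rightarrow> complex"
  assumes p: "0 < p" and f: "\<And>j. f j \<in> bloch p" "\<And>j. bloch_norm p (f j) \<le> M"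
  obtains g r where "strict_mono (r :: nat \<Rightarrow> nat)" "g \<in> bloch p"
    "\<And>z. z \<in> polydisk \<Longrightarrow> bloch_weight p g z \<le> M"
    "\<And>z. z \<in> polydisk \<Longrightarrow> (\<lambda>j. f (r j) z) \<longlonglongrightarrow> g z"
    "\<And>\<rho> k. 0 \<le> \<rho> \<Longrightarrow> \<rho> < 1 \<Longrightarrow>
      uniform_limit (closed_polydisk \<rho>) (\<lambda>j. cpartial k (f (r j))) (cpartial k g) sequentially"
proof -
  obtain T :: "(complex ^ 'n) set" where T: "countable T" "T \<subseteq> polydisk" "polydisk \<subseteq> closure T"
    using separable by blast
  have "\<exists>C. 0 \<le> C \<and> (\<forall>h \<in> bloch p. cmod (h z) \<le> C * bloch_norm p h)" if "z \<in> polydisk" for z :: "complex ^ 'n"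
    using bloch_point_evaluation[OF p that] by metis
  then obtain C where C: "\<And>z :: complex ^ 'n. z \<in> polydisk \<Longrightarrow> 0 \<le> C z"
    "\<And>z h. z \<in> polydisk \<Longrightarrow> h \<in> bloch p \<Longrightarrow> cmod (h z) \<le> C z * bloch_norm p h"
    by metis
  have M: "0 \<le> M" using bloch_norm_nonneg[OF f(1)[of 0]] f(2)[of 0] by linarith
  \<comment> \<open>Division by \<open>C t + 1\<close> replaces the bounds depending on the point by
    the common bound \<open>M\<close> that the diagonal argument asks for.\<close>
  define s where "s j t = f j t / complex_of_real (C t + 1)" for j t
  have "cmod (s j t) \<le> M" if "t \<in> T" for j t
  proof -
    have t: "t \<in> polydisk" using that T by auto
    have "cmod (f j t) \<le> C t * M"
      using C(2)[OF t f(1)[of j]] mult_left_mono[OF f(2)[of j] C(1)[OF t]] by linarith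
    also have "\<dots> \<le> (C t + 1) * M" using M by (simp add: algebra_simps)
    finally show ?thesis
      using C(1)[OF t] by (simp add: s_def norm_divide divide_simps mult.commute del: of_real_add)
  qed
  then obtain r where r: "strict_mono (r :: nat \<Rightarrow> nat)" "\<And>t. t \<in> T \<Longrightarrow> \<exists>l. (\<lambda>j. s (r j) t) \<longlonglongrightarrow> l"
    using function_convergent_subsequence[OF T(1), of s M] by metis
  have conv: "convergent (\<lambda>j. f (r j) t)" if "t \<in> T" for t
  proof -
    have "complex_of_real (C t + 1) \<noteq> 0" using C(1)[of t] T that by (auto simp del: of_real_add)
    moreover obtain l where "(\<lambda>j. s (r j) t) \<longlonglongrightarrow> l" using r(2)[OF \<open>t \<in> T\<close>] by blast
    from tendsto_mult[OF this tendsto_const[of "complex_of_real (C t + 1)"]]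
    have "(\<lambda>j. s (r j) t * complex_of_real (C t + 1)) \<longlonglongrightarrow> l * complex_of_real (C t + 1)" .
    ultimately show ?thesis
      unfolding s_def convergent_def by (auto simp del: of_real_add)
  qed
  have hol: "holomorphic_n polydisk (f j)" for j using f(1) by (rule bloch_holomorphic)
  have UC: "uniformly_Cauchy_on (closed_polydisk \<rho>) (\<lambda>j. f (r j))" if "0 \<le> \<rho>" "\<rho> < 1" for \<rho>
    by (rule bloch_uniformly_Cauchy_on_closed_polydisk[OF p f(1) f(2) T(3,2) conv that])
  have pointwise: "(\<lambda>j. f (r j) z) \<longlonglongrightarrow> lim (\<lambda>j. f (r j) z)" if "z \<in> polydisk" for z
  proof -
    obtain \<rho> where "0 \<le> \<rho>" "\<rho> < 1" "z \<in> closed_polydisk \<rho>" using point_in_closed_polydisk[OF \<open>z \<in> polydisk\<close>] .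
    then have "uniformly_convergent_on (closed_polydisk \<rho>) (\<lambda>j. f (r j))"
      by (intro Cauchy_uniformly_convergent UC)
    from uniformly_convergent_imp_convergent[OF this \<open>z \<in> closed_polydisk \<rho>\<close>]
    show ?thesis by (simp add: convergent_LIMSEQ_iff)
  qed
  define c where "c k z = lim (\<lambda>j. cpartial k (f (r j)) z)" for k z
  have Uc: "uniform_limit (closed_polydisk \<rho>) (\<lambda>j. cpartial k (f (r j))) (c k) sequentially"
    if "0 \<le> \<rho>" "\<rho> < 1" for \<rho> k
  proof -
    have \<rho>': "\<rho> < (1 + \<rho>) / 2" "0 \<le> (1 + \<rho>) / 2" "(1 + \<rho>) / 2 < 1" using that by (auto simp: field_simps)
    have "uniformly_convergent_on (closed_polydisk \<rho>) (\<lambda>j. cpartial k (f (r j)))"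
      by (intro Cauchy_uniformly_convergent cpartial_uniformly_Cauchy[OF hol \<rho>'(1,3) UC[OF \<rho>'(2,3)]])
    then show ?thesis
      unfolding uniformly_convergent_uniform_limit_iff c_def .
  qed
  define g where "g = zero_ext (\<lambda>z. lim (\<lambda>j. f (r j) z))"
  have g: "(\<lambda>j. f (r j) z) \<longlonglongrightarrow> g z" if "z \<in> polydisk" for z
    using pointwise[OF that] that by (simp add: g_def zero_ext_def)
  have D: "(g has_derivative (\<lambda>h. \<Sum>k\<in>UNIV. c k z * h $ k)) (at z)" if "z \<in> polydisk" for z
  proof -
    obtain \<rho>0 where \<rho>0: "0 \<le> \<rho>0" "\<rho>0 < 1" "z \<in> closed_polydisk \<rho>0" using point_in_closed_polydisk[OF \<open>z \<in> polydisk\<close>] .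
    \<comment> \<open>The radius is enlarged so that \<open>z\<close> is interior and the derivative
      within the closed polydisk becomes a full one.\<close>
    define \<rho> where "\<rho> = (1 + \<rho>0) / 2"
    have \<rho>: "0 \<le> \<rho>" "\<rho> < 1" "\<rho>0 < \<rho>" using \<rho>0 by (auto simp: \<rho>_def field_simps)
    let ?S = "closed_polydisk \<rho> :: (complex ^ 'n) set"
    have sub: "?S \<subseteq> polydisk" by (rule closed_polydisk_subset[OF \<rho>(2)])
    have int: "z \<in> interior ?S" by (rule in_interior_closed_polydisk[OF \<rho>0(3) \<rho>(3)])
    then have zS: "z \<in> ?S" using interior_subset by blast
    have ex: "\<exists>g'. \<forall>x\<in>?S. (\<lambda>n. f (r n) x) \<longlonglongrightarrow> g' x \<and>
        (g' has_derivative (\<lambda>h. \<Sum>k\<in>UNIV. c k x * h $ k)) (at x within ?S)"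
    proof (rule has_derivative_sequence[OF convex_closed_polydisk])
      show "(f (r n) has_derivative (\<lambda>h. \<Sum>k\<in>UNIV. cpartial k (f (r n)) x * h $ k)) (at x within ?S)"
        if "x \<in> ?S" for n x
        by (rule has_derivative_at_withinI[OF holomorphic_n_has_derivative[OF hol subsetD[OF sub that]]])
      show "\<forall>\<^sub>F n in sequentially. \<forall>x\<in>?S. \<forall>h.
          cmod ((\<Sum>k\<in>UNIV. cpartial k (f (r n)) x * h $ k) - (\<Sum>k\<in>UNIV. c k x * h $ k)) \<le> e * norm h"
        if e: "0 < e" for e
      proof -
        have "\<forall>\<^sub>F n in sequentially. \<forall>k. \<forall>x\<in>?S. dist (cpartial k (f (r n)) x) (c k x) < e / real CARD('n)"
          using uniform_limitD[OF Uc[OF \<rho>(1,2)], of "e / real CARD('n)"] e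
          by (intro eventually_all_finite) simp
        then show ?thesis
        proof (rule eventually_mono, intro ballI allI)
          fix n x and h :: "complex ^ 'n"
          assume n: "\<forall>k. \<forall>x\<in>?S. dist (cpartial k (f (r n)) x) (c k x) < e / real CARD('n)" and x: "x \<in> ?S"
          have "(\<Sum>k\<in>UNIV. cpartial k (f (r n)) x * h $ k) - (\<Sum>k\<in>UNIV. c k x * h $ k)
              = (\<Sum>k\<in>UNIV. (cpartial k (f (r n)) x - c k x) * h $ k)"
            by (simp add: sum_subtractf left_diff_distrib)
          also have "cmod \<dots> \<le> (\<Sum>k\<in>(UNIV :: 'n set). e / real CARD('n) * norm h)"
          proof (rule order_trans[OF norm_sum sum_mono])
            fix k
            have "cmod (cpartial k (f (r n)) x - c k x) \<le> e / real CARD('n)"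
              using n x by (auto simp: dist_norm intro: less_imp_le)
            then show "cmod ((cpartial k (f (r n)) x - c k x) * h $ k) \<le> e / real CARD('n) * norm h"
              unfolding norm_mult using e by (intro mult_mono Finite_Cartesian_Product.norm_nth_le) auto
          qed
          finally show "cmod ((\<Sum>k\<in>UNIV. cpartial k (f (r n)) x * h $ k) - (\<Sum>k\<in>UNIV. c k x * h $ k)) \<le> e * norm h"
            by simp
        qed
      qed
      show "(\<lambda>n. f (r n) z) \<longlonglongrightarrow> g z" by (rule g[OF \<open>z \<in> polydisk\<close>])
    qed (rule zS)
    obtain g' where g': "\<forall>x\<in>?S. (\<lambda>n. f (r n) x) \<longlonglongrightarrow> g' x \<and>
        (g' has_derivative (\<lambda>h. \<Sum>k\<in>UNIV. c k x * h $ k)) (at x within ?S)"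
      using ex ..
    \<comment> \<open>Termwise differentiation provides its own limit function \<open>g'\<close>;
      uniqueness of limits identifies it with \<open>g\<close>.\<close>
    have "g x = g' x" if "x \<in> ?S" for x
      by (rule LIMSEQ_unique[OF g[OF subsetD[OF sub that]] bspec[OF g' that, THEN conjunct1]])
    from has_derivative_transform[OF zS this bspec[OF g' zS, THEN conjunct2]]
    have "(g has_derivative (\<lambda>h. \<Sum>k\<in>UNIV. c k z * h $ k)) (at z within ?S)" .
    then show ?thesis by (simp add: at_within_interior[OF int])
  qed
  have cg: "cpartial k g z = c k z" if "z \<in> polydisk" for k z
    by (rule cpartial_eqI[OF D[OF that]])
  have Ug: "uniform_limit (closed_polydisk \<rho>) (\<lambda>j. cpartial k (f (r j))) (cpartial k g) sequentially"
    if \<rho>: "0 \<le> \<rho>" "\<rho> < 1" for \<rho> k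
    by (rule uniform_limit_cong'[THEN iffD1, OF refl _ Uc[OF \<rho>]])
      (use cg closed_polydisk_subset[OF \<rho>(2)] in auto)
  have bw: "bloch_weight p g z \<le> M" if z: "z \<in> polydisk" for z
  proof (rule tendsto_upperbound)
    obtain \<rho> where \<rho>: "0 \<le> \<rho>" "\<rho> < 1" "z \<in> closed_polydisk \<rho>" using point_in_closed_polydisk[OF z] .
    show "(\<lambda>j. bloch_weight p (f (r j)) z) \<longlonglongrightarrow> bloch_weight p g z"
      unfolding bloch_weight_def by (intro tendsto_intros tendsto_uniform_limitI[OF Ug[OF \<rho>(1,2)] \<rho>(3)])
    show "\<forall>\<^sub>F j in sequentially. bloch_weight p (f (r j)) z \<le> M"
      using bloch_norm_bounds(2)[OF f(1) z] f(2) by (intro always_eventually allI) (rule order_trans)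
  qed simp
  \<comment> \<open>\<open>g\<close> already vanishes off the polydisk, so \<open>zero_ext g\<close>
    is \<open>g\<close>.\<close>
  have "zero_ext g \<in> bloch p"
    by (rule zero_ext_in_bloch[OF holomorphic_nI[OF D] bw])
  then have "g \<in> bloch p" by (simp add: g_def zero_ext_def if_distrib cong: if_cong)
  then show ?thesis using that r(1) bw g Ug by blast
qed

subsection \<open>Sufficiency of the boundary condition\<close>

text \<open>Chain rule and exchange of sums separate the gradient of \<open>u\<close> at
  \<open>\<phi> z\<close> from a factor that depends on \<open>\<phi>\<close> alone.\<close>

lemma bloch_weight_comp_op_le:
  fixes \<phi> :: "complex ^ 'n \<Rightarrow> complex ^ 'n"
  assumes "holomorphic_self_map \<phi>" "holomorphic_n polydisk u" "z \<in> polydisk"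
  shows "bloch_weight q (comp_op \<phi> u) z \<le> (\<Sum>l\<in>UNIV. cmod (cpartial l u (\<phi> z)) * component_weight q \<phi> l z)"
proof -
  have "bloch_weight q (comp_op \<phi> u) z \<le> (\<Sum>k\<in>UNIV. (\<Sum>l\<in>UNIV. cmod (cpartial l u (\<phi> z)) *
      cmod (cpartial k (\<lambda>w. \<phi> w $ l) z)) * (1 - (cmod (z $ k))\<^sup>2) powr q)"
    unfolding bloch_weight_def cpartial_comp_op[OF assms]
    by (intro sum_mono mult_right_mono order_trans[OF norm_sum]) (auto simp: norm_mult)
  also have "\<dots> = (\<Sum>l\<in>UNIV. cmod (cpartial l u (\<phi> z)) * component_weight q \<phi> l z)"
    unfolding component_weight_def sum_distrib_left sum_distrib_right
    by (subst sum.swap) (simp add: mult.assoc)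
  finally show ?thesis .
qed

text \<open>The coordinates of \<open>\<phi>\<close> are images of the coordinate monomials, hence
  q-Bloch functions whose norms bound the component weights.\<close>

lemma component_weight_bounded:
  fixes \<phi> :: "complex ^ 'n \<Rightarrow> complex ^ 'n"
  assumes T: "linear_operator (little_bloch p) (little_bloch q) (comp_op \<phi>)"
    and \<phi>: "holomorphic_self_map \<phi>" and p: "0 < p"
  obtains W where "0 \<le> W" "\<And>z. z \<in> polydisk \<Longrightarrow> (\<Sum>l\<in>UNIV. component_weight q \<phi> l z) \<le> W"
proof -
  have hol: "holomorphic_n polydisk (\<lambda>z. \<phi> z $ l)" for l using \<phi> by (simp add: holomorphic_self_map_def)
  define h where "h l = zero_ext (\<lambda>z. \<phi> z $ l)" for l
  have "zero_ext (\<lambda>z. \<Prod>i\<in>UNIV. (\<phi> z $ i) ^ (if i = l then 1 else 0)) \<in> little_bloch q" for l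
    by (rule linear_operator_monomials[OF T \<phi> p])
  moreover have "(\<Prod>i\<in>UNIV. (\<phi> z $ i) ^ (if i = l then 1 else 0)) = \<phi> z $ l" for z l
    by (simp add: if_distrib prod.delta cong: if_cong)
  ultimately have h: "h l \<in> bloch q" for l
    using little_bloch_subset[of q] by (auto simp: h_def)
  have "component_weight q \<phi> l z \<le> bloch_norm q (h l)" if "z \<in> polydisk" for l z
    using bloch_norm_bounds(2)[OF h that, of l] bloch_weight_zero_ext[OF hol that, of q l]
    by (simp add: h_def component_weight_def bloch_weight_def)
  then show ?thesis
    using that[of "\<Sum>l\<in>UNIV. bloch_norm q (h l)"] bloch_norm_nonneg[OF h] by (simp add: sum_mono sum_nonneg)
qed

text \<open>Points of the closure at distance at least \<open>\<delta>\<close> from the frontier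
  form a compact set that misses the frontier, hence lies in the open polydisk.\<close>

lemma polydisk_away_from_frontier:
  assumes "0 < \<delta>"
  obtains \<rho> where "0 \<le> \<rho>" "\<rho> < 1"
    "\<And>w :: complex ^ 'n. w \<in> polydisk \<Longrightarrow> \<delta> \<le> infdist w (frontier polydisk) \<Longrightarrow> w \<in> closed_polydisk \<rho>"
proof -
  let ?U = "polydisk :: (complex ^ 'n) set"
  let ?K = "closure ?U \<inter> {w. \<delta> \<le> infdist w (frontier ?U)}"
  have "bounded ?U"
    by (rule bounded_subset[OF compact_imp_bounded[OF compact_closed_polydisk[of 1]]])
      (auto simp: polydisk_def closed_polydisk_def less_imp_le)
  then have "compact ?K"
    by (intro compact_Int_closed closed_Collect_le continuous_intros) (simp add: compact_closure)
  moreover have "?K \<subseteq> ?U"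
  proof
    fix w assume w: "w \<in> ?K"
    then have "w \<notin> frontier ?U" using assms by auto
    then show "w \<in> ?U" using w interior_open[OF open_polydisk] by (auto simp: frontier_def)
  qed
  ultimately obtain \<rho> where "0 \<le> \<rho>" "\<rho> < 1" "?K \<subseteq> closed_polydisk \<rho>"
    using compact_subset_closed_polydisk by blast
  then show ?thesis using that closure_subset[of ?U] by blast
qed

lemma comp_op_convergent_subsequence:
  fixes \<phi> :: "complex ^ 'n \<Rightarrow> complex ^ 'n"
  assumes T: "linear_operator (little_bloch p) (little_bloch q) (comp_op \<phi>)"
    and bc: "boundary_condition p q \<phi>"
    and \<phi>: "holomorphic_self_map \<phi>" and p: "0 < p"
    and f: "\<And>j :: nat. f j \<in> little_bloch p" "\<And>j. bloch_norm p (f j) \<le> M"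
  obtains h r where "strict_mono (r :: nat \<Rightarrow> nat)" "h \<in> little_bloch q"
    "\<And>e. 0 < e \<Longrightarrow> \<forall>\<^sub>F j in sequentially. bloch_norm q (\<lambda>z. comp_op \<phi> (f (r j)) z - h z) < e"
proof -
  have fb: "f j \<in> bloch p" for j using f(1) little_bloch_subset by blast
  obtain g r where r: "strict_mono (r :: nat \<Rightarrow> nat)" and g: "g \<in> bloch p"
    "\<And>z. z \<in> polydisk \<Longrightarrow> bloch_weight p g z \<le> M"
    "\<And>z. z \<in> polydisk \<Longrightarrow> (\<lambda>j. f (r j) z) \<longlonglongrightarrow> g z"
    "\<And>\<rho> k. 0 \<le> \<rho> \<Longrightarrow> \<rho> < 1 \<Longrightarrow>
      uniform_limit (closed_polydisk \<rho>) (\<lambda>j. cpartial k (f (r j))) (cpartial k g) sequentially"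
  proof (rule bloch_Montel[where f = f, OF p fb f(2)])
    fix g r assume *: "strict_mono (r :: nat \<Rightarrow> nat)" "g \<in> bloch p"
      "\<And>z. z \<in> polydisk \<Longrightarrow> bloch_weight p g z \<le> M"
      "\<And>z. z \<in> polydisk \<Longrightarrow> (\<lambda>j. f (r j) z) \<longlonglongrightarrow> g z"
      "\<And>\<rho> k. 0 \<le> \<rho> \<Longrightarrow> \<rho> < 1 \<Longrightarrow>
        uniform_limit (closed_polydisk \<rho>) (\<lambda>j. cpartial k (f (r j))) (cpartial k g) sequentially"
    show thesis by (rule that[of r g]; fact *)
  qed
  have M: "0 \<le> M" using bloch_norm_nonneg[OF fb[of 0]] f(2)[of 0] by linarith
  obtain W where W: "0 \<le> W" "\<And>z. z \<in> polydisk \<Longrightarrow> (\<Sum>l\<in>UNIV. component_weight q \<phi> l z) \<le> W"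
    using component_weight_bounded[OF T \<phi> p] by blast
  define u where "u j = (\<lambda>z. f (r j) z - g z)" for j
  have ub: "u j \<in> bloch p" for j unfolding u_def by (rule bloch_diff[OF fb g(1)])
  have uhol: "holomorphic_n polydisk (u j)" for j by (rule bloch_holomorphic[OF ub])
  have ucp: "cpartial k (u j) z = cpartial k (f (r j)) z - cpartial k g z" if "z \<in> polydisk" for k j z
    unfolding u_def by (rule cpartial_diff[OF bloch_holomorphic[OF fb] bloch_holomorphic[OF g(1)] that])
  have uw: "bloch_weight p (u j) z \<le> 2 * M" if z: "z \<in> polydisk" for j z
  proof -
    have "bloch_weight p (u j) z \<le> bloch_weight p (f (r j)) z + bloch_weight p g z"
      by (rule bloch_weight_triangle) (simp add: ucp[OF z] norm_triangle_ineq4)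
    then show ?thesis using g(2)[OF z] bloch_norm_bounds(2)[OF fb z, of "r j"] f(2)[of "r j"] by linarith
  qed
  define v where "v j = comp_op \<phi> (u j)" for j
  have v_eq: "v j = (\<lambda>z. comp_op \<phi> (f (r j)) z - comp_op \<phi> g z)" for j
    by (auto simp: v_def u_def comp_op_def zero_ext_def)
  have vweight: "\<forall>\<^sub>F j in sequentially. \<forall>z\<in>polydisk. bloch_weight q (v j) z \<le> e" if e: "0 < e" for e
  proof -
    \<comment> \<open>\<open>2 * M\<close> bounds the weights of the differences \<open>u j\<close>,
      so with this tolerance the region near the frontier contributes at most \<open>e\<close>; the
      summand 1 covers \<open>M = 0\<close>.\<close>
    have "0 < e / (2 * M + 1)" using e M by simp
    then obtain \<delta> where \<delta>: "0 < \<delta>" "\<And>z. z \<in> polydisk \<Longrightarrow> infdist (\<phi> z) (frontier polydisk) < \<delta> \<Longrightarrow>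
        \<bar>\<Sum>l\<in>UNIV. component_weight q \<phi> l z / (1 - (cmod (\<phi> z $ l))\<^sup>2) powr p\<bar> < e / (2 * M + 1)"
      using bc unfolding boundary_condition_def tends_to_zero_at_boundary_def boundary_sum_eq
      by blast
    obtain \<rho> where \<rho>: "0 \<le> \<rho>" "\<rho> < 1"
      "\<And>w :: complex ^ 'n. w \<in> polydisk \<Longrightarrow> \<delta> \<le> infdist w (frontier polydisk) \<Longrightarrow> w \<in> closed_polydisk \<rho>"
      using polydisk_away_from_frontier[OF \<delta>(1)] by blast
    have "\<forall>\<^sub>F j in sequentially. \<forall>k. \<forall>w\<in>closed_polydisk \<rho>. dist (cpartial k (f (r j)) w) (cpartial k g w) < e / (W + 1)"
      using uniform_limitD[OF g(4)[OF \<rho>(1,2)], of "e / (W + 1)"] e W by (intro eventually_all_finite) simp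
    then show ?thesis
    proof (rule eventually_mono, intro ballI)
      fix j and z :: "complex ^ 'n"
      assume j: "\<forall>k. \<forall>w\<in>closed_polydisk \<rho>. dist (cpartial k (f (r j)) w) (cpartial k g w) < e / (W + 1)"
        and z: "z \<in> polydisk"
      have \<phi>z: "\<phi> z \<in> polydisk" by (rule self_map_in_polydisk[OF \<phi> z])
      have "bloch_weight q (v j) z \<le> (\<Sum>l\<in>UNIV. cmod (cpartial l (u j) (\<phi> z)) * component_weight q \<phi> l z)"
        unfolding v_def by (rule bloch_weight_comp_op_le[OF \<phi> uhol z])
      also have "\<dots> \<le> e"
      proof (cases "infdist (\<phi> z) (frontier polydisk) < \<delta>")
        case True
        have "(\<Sum>l\<in>UNIV. cmod (cpartial l (u j) (\<phi> z)) * component_weight q \<phi> l z)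
          \<le> (\<Sum>l\<in>UNIV. 2 * M * (component_weight q \<phi> l z / (1 - (cmod (\<phi> z $ l))\<^sup>2) powr p))"
        proof (rule sum_mono)
          fix l
          have "cmod (cpartial l (u j) (\<phi> z)) * (1 - (cmod (\<phi> z $ l))\<^sup>2) powr p \<le> 2 * M"
            by (rule order_trans[OF cpartial_weighted_le uw[OF \<phi>z]])
          then have "cmod (cpartial l (u j) (\<phi> z)) \<le> 2 * M / (1 - (cmod (\<phi> z $ l))\<^sup>2) powr p"
            using polydisk_component_bounds(2)[OF \<phi>z, of l] by (simp add: pos_le_divide_eq)
          from mult_right_mono[OF this component_weight_nonneg]
          show "cmod (cpartial l (u j) (\<phi> z)) * component_weight q \<phi> l z
              \<le> 2 * M * (component_weight q \<phi> l z / (1 - (cmod (\<phi> z $ l))\<^sup>2) powr p)" by simp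
        qed
        also have "\<dots> = 2 * M * (\<Sum>l\<in>UNIV. component_weight q \<phi> l z / (1 - (cmod (\<phi> z $ l))\<^sup>2) powr p)"
          by (simp add: sum_distrib_left)
        also have "\<dots> \<le> 2 * M * (e / (2 * M + 1))"
          using \<delta>(2)[OF z True] M by (intro mult_left_mono) auto
        also have "\<dots> \<le> e" using M e by (simp add: field_simps)
        finally show ?thesis .
      next
        case False
        then have K: "\<phi> z \<in> closed_polydisk \<rho>" using \<rho>(3)[OF \<phi>z] by simp
        have "(\<Sum>l\<in>UNIV. cmod (cpartial l (u j) (\<phi> z)) * component_weight q \<phi> l z)
          \<le> (\<Sum>l\<in>UNIV. e / (W + 1) * component_weight q \<phi> l z)"
          using j K by (intro sum_mono mult_right_mono component_weight_nonneg)
            (auto simp: ucp[OF \<phi>z] dist_norm intro: less_imp_le)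
        also have "\<dots> = e / (W + 1) * (\<Sum>l\<in>UNIV. component_weight q \<phi> l z)"
          by (simp add: sum_distrib_left)
        also have "\<dots> \<le> e / (W + 1) * W" using W e z by (intro mult_left_mono) auto
        also have "\<dots> \<le> e" using W(1) e by (simp add: field_simps)
        finally show ?thesis .
      qed
      finally show "bloch_weight q (v j) z \<le> e" .
    qed
  qed
  have v: "\<forall>\<^sub>F j in sequentially. v j \<in> bloch q \<and> bloch_norm q (v j) < e" if e: "0 < e" for e
  proof -
    \<comment> \<open>The norm includes the value at 0, which after composition is the value of
      \<open>u j\<close> at \<open>\<phi> 0\<close>.\<close>
    have "(\<lambda>j. f (r j) (\<phi> 0) - g (\<phi> 0)) \<longlonglongrightarrow> 0"
      using g(3)[OF self_map_in_polydisk[OF \<phi> zero_in_polydisk]] by (rule LIM_zero)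
    from tendstoD[OF this half_gt_zero[OF e]]
    have "\<forall>\<^sub>F j in sequentially. cmod (f (r j) (\<phi> 0) - g (\<phi> 0)) < e / 2"
      unfolding dist_norm diff_zero .
    with vweight[OF half_gt_zero[OF e]] show ?thesis
    proof eventually_elim
      case (elim j)
      have "zero_ext (v j) \<in> bloch q"
        using elim holomorphic_n_zero_ext[OF holomorphic_n_comp[OF \<phi> uhol]]
        by (intro zero_ext_in_bloch[of _ _ "e / 2"]) (auto simp: v_def comp_op_def)
      moreover have "zero_ext (v j) = v j" by (auto simp: v_def comp_op_def zero_ext_def)
      moreover have "bloch_norm q (v j) \<le> cmod (v j 0) + e / 2"
        using elim by (intro bloch_norm_le) auto
      moreover have "v j 0 = f (r j) (\<phi> 0) - g (\<phi> 0)"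
        by (simp add: v_def u_def comp_op_def zero_ext_def zero_in_polydisk)
      ultimately show ?case using elim by simp
    qed
  qed
  have Tf: "comp_op \<phi> (f j) \<in> little_bloch q" for j using T f(1) by (auto simp: linear_operator_def)
  have Tfb: "comp_op \<phi> (f j) \<in> bloch q" for j using Tf little_bloch_subset by blast
  \<comment> \<open>The mapping property of the operator concerns little Bloch functions, so
    \<open>comp_op \<phi> g\<close> is instead written as a difference of two q-Bloch
    functions.\<close>
  have Tg: "comp_op \<phi> g \<in> bloch q"
  proof -
    obtain j where "v j \<in> bloch q" using eventually_happens[OF v[OF zero_less_one]] by auto
    from bloch_diff[OF Tfb[of "r j"] this] show ?thesis unfolding v_eq by simp
  qed
  have "comp_op \<phi> g \<in> little_bloch q"
  proof (rule little_bloch_closed[OF Tg])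
    fix e :: real assume "0 < e"
    then obtain j where "bloch_norm q (v j) < e" using eventually_happens[OF v[OF \<open>0 < e\<close>]] by auto
    then show "\<exists>h\<in>little_bloch q. bloch_norm q (\<lambda>z. comp_op \<phi> g z - h z) < e"
      unfolding v_eq bloch_norm_commute[OF Tfb Tg] using Tf by blast
  qed
  with r show ?thesis
  proof (rule that)
    fix e :: real assume "0 < e"
    from v[OF this] show "\<forall>\<^sub>F j in sequentially.
        bloch_norm q (\<lambda>z. comp_op \<phi> (f (r j)) z - comp_op \<phi> g z) < e"
      unfolding v_eq by (rule eventually_mono) blast
  qed
qed

text \<open>Compactness is checked by sequences. Members of the closure need not be images, so each
  \<open>\<sigma> j\<close> is paired with an image within \<open>inverse (real (Suc j))\<close>; a
  subsequence along which these images converge also serves \<open>\<sigma>\<close>.\<close>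

lemma boundary_condition_imp_compact:
  fixes \<phi> :: "complex ^ 'n \<Rightarrow> complex ^ 'n"
  assumes T: "linear_operator (little_bloch p) (little_bloch q) (comp_op \<phi>)"
    and bc: "boundary_condition p q \<phi>"
    and \<phi>: "holomorphic_self_map \<phi>" and p: "0 < p"
  shows "compact_operator (little_bloch p) (bloch_norm p) (little_bloch q) (bloch_norm q) (comp_op \<phi>)"
  unfolding compact_operator_def norm_topology_def
proof (intro conjI T allI impI)
  interpret Metric_space "little_bloch q" "norm_dist (little_bloch q) (bloch_norm q)"
    by (rule little_bloch_metric)
  let ?T = "comp_op \<phi>" and ?d = "norm_dist (little_bloch q) (bloch_norm q)"
  fix B :: "(complex ^ 'n \<Rightarrow> complex) set"
  assume B: "B \<subseteq> little_bloch p" "\<exists>M. \<forall>f\<in>B. bloch_norm p f \<le> M"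
  then obtain M where M: "\<And>f. f \<in> B \<Longrightarrow> bloch_norm p f \<le> M" by blast
  show "compactin mtopology (mtopology closure_of (?T ` B))"
    unfolding compactin_sequentially
  proof (intro conjI allI impI)
    show "mtopology closure_of (?T ` B) \<subseteq> little_bloch q"
      using closure_of_subset_topspace[of mtopology] by simp
    fix \<sigma> :: "nat \<Rightarrow> complex ^ 'n \<Rightarrow> complex" assume \<sigma>: "range \<sigma> \<subseteq> mtopology closure_of (?T ` B)"
    have "\<exists>b\<in>B. \<sigma> j \<in> little_bloch q \<and> ?T b \<in> little_bloch q \<and> ?d (\<sigma> j) (?T b) < inverse (real (Suc j))" for j
    proof -
      have "\<sigma> j \<in> mtopology closure_of (?T ` B)" using \<sigma> by auto
      then have "\<exists>y\<in>?T ` B. y \<in> mball (\<sigma> j) (inverse (real (Suc j)))"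
        unfolding metric_closure_of by (auto simp del: of_nat_Suc)
      then show ?thesis by (auto simp: in_mball simp del: of_nat_Suc)
    qed
    then obtain b where b: "\<And>j. b j \<in> B" "\<And>j. \<sigma> j \<in> little_bloch q" "\<And>j. ?T (b j) \<in> little_bloch q"
      "\<And>j. ?d (\<sigma> j) (?T (b j)) < inverse (real (Suc j))" by metis
    obtain h r where r: "strict_mono (r :: nat \<Rightarrow> nat)" "h \<in> little_bloch q"
      "\<And>e. 0 < e \<Longrightarrow> \<forall>\<^sub>F j in sequentially. bloch_norm q (\<lambda>z. ?T (b (r j)) z - h z) < e"
    proof (rule comp_op_convergent_subsequence[OF T bc \<phi> p, of b M])
      show "b j \<in> little_bloch p" "bloch_norm p (b j) \<le> M" for j
        using B(1) b(1)[of j] M by auto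
      fix h r assume *: "strict_mono (r :: nat \<Rightarrow> nat)" "h \<in> little_bloch q"
        "\<And>e. 0 < e \<Longrightarrow> \<forall>\<^sub>F j in sequentially. bloch_norm q (\<lambda>z. ?T (b (r j)) z - h z) < e"
      show thesis by (rule that[of r h]; fact *)
    qed
    have ev: "\<forall>\<^sub>F j in sequentially. ?d (?T (b (r j))) h < e" if "0 < e" for e
      using r(3)[OF that] by (rule eventually_mono) (simp add: norm_dist_def b(3) r(2))
    have "h \<in> mtopology closure_of (?T ` B)"
      unfolding metric_closure_of
    proof (intro CollectI conjI r(2) allI impI)
      fix e :: real assume "0 < e"
      then obtain j where "?d (?T (b (r j))) h < e" using eventually_happens[OF ev] by auto
      then show "\<exists>y\<in>?T ` B. y \<in> mball h e"
        using b(1,3) r(2) by (intro bexI[of _ "?T (b (r j))"]) (auto simp: in_mball commute)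
    qed
    moreover have "limitin mtopology (\<sigma> \<circ> r) h sequentially"
      unfolding limitin_metric
    proof (intro conjI r(2) allI impI)
      fix e :: real assume e: "0 < e"
      have "(\<lambda>j. inverse (real (Suc (r j)))) \<longlonglongrightarrow> 0"
        using LIMSEQ_subseq_LIMSEQ[OF LIMSEQ_inverse_real_of_nat r(1)] by (simp add: o_def)
      then have "\<forall>\<^sub>F j in sequentially. inverse (real (Suc (r j))) < e / 2"
        using half_gt_zero[OF e] by (rule order_tendstoD)
      with ev[OF half_gt_zero[OF e]]
      show "\<forall>\<^sub>F j in sequentially. (\<sigma> \<circ> r) j \<in> little_bloch q \<and> ?d ((\<sigma> \<circ> r) j) h < e"
      proof eventually_elim
        case (elim j)
        then show ?case
          using triangle[OF b(2)[of "r j"] b(3)[of "r j"] r(2)] b(4)[of "r j"] b(2)[of "r j"] by simp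
      qed
    qed
    ultimately show "\<exists>l r. l \<in> mtopology closure_of (?T ` B) \<and> strict_mono (r :: nat \<Rightarrow> nat) \<and>
        limitin mtopology (\<sigma> \<circ> r) l sequentially"
      using r(1) by blast
  qed
qed

theorem theorem6p3:
  fixes \<phi> :: "complex ^ 'n \<Rightarrow> complex ^ 'n" and p q :: real
  assumes "holomorphic_self_map \<phi>" and "0 < p" and "0 < q"
  shows "(bounded_operator (little_bloch p) (bloch_norm p) (little_bloch q) (bloch_norm q)
            (comp_op \<phi>) \<and>
          boundary_condition p q \<phi> \<longrightarrow>
          compact_operator (little_bloch p) (bloch_norm p) (little_bloch q) (bloch_norm q)
            (comp_op \<phi>)) \<and>
         (1 \<le> p \<and>
          compact_operator (little_bloch p) (bloch_norm p) (little_bloch q) (bloch_norm q)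
            (comp_op \<phi>) \<longrightarrow>
          (\<forall>\<gamma> :: 'n \<Rightarrow> nat.
             zero_ext (\<lambda>z. \<Prod>l\<in>UNIV. (\<phi> z $ l) ^ \<gamma> l) \<in> little_bloch q) \<and>
          boundary_condition p q \<phi>)"
proof (intro conjI impI allI; elim conjE)
  assume "bounded_operator (little_bloch p) (bloch_norm p) (little_bloch q) (bloch_norm q) (comp_op \<phi>)"
    and "boundary_condition p q \<phi>"
  then show "compact_operator (little_bloch p) (bloch_norm p) (little_bloch q) (bloch_norm q) (comp_op \<phi>)"
    using assms by (intro boundary_condition_imp_compact) (auto simp: bounded_operator_def)
next
  fix \<gamma> :: "'n \<Rightarrow> nat"
  assume "compact_operator (little_bloch p) (bloch_norm p) (little_bloch q) (bloch_norm q) (comp_op \<phi>)"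
  then show "zero_ext (\<lambda>z. \<Prod>l\<in>UNIV. (\<phi> z $ l) ^ \<gamma> l) \<in> little_bloch q"
    using assms by (intro linear_operator_monomials[of p]) (auto simp: compact_operator_def)
next
  assume "1 \<le> p"
    and "compact_operator (little_bloch p) (bloch_norm p) (little_bloch q) (bloch_norm q) (comp_op \<phi>)"
  then show "boundary_condition p q \<phi>"
    using assms by (intro compact_imp_boundary_condition)
qed

end
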